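(* Let $f,c,\mathcal{A}$ satisfy the standing assumptions stated in the context, and suppose in addition that $f$, $c$ and $\mathcal{A}$ are twice differentiable in $\mathbb{R}^n$. Let $x\in\mathcal{M}=\{x\in\mathbb{R}^n:c(x)=0\}$ and $\beta>\tilde\beta_x$. Then the constrained problem $\min\{f(x):x\in\mathbb{R}^n,\ c(x)=0\}$ and the unconstrained minimization of $h(y)=f(\mathcal{A}(y))+\frac{\beta}{2}\|c(y)\|^2$ have the same second-order stationary points over $\Omega_x$; that is, a point $y\in\Omega_x$ is a second-order stationary point of the constrained problem if and only if it is a second-order stationary point of $h$.
   Context: **Setting and standing assumptions.** $\|\cdot\|$ is the Euclidean norm of vectors or the spectral norm of matrices; $\sigma_s(\cdot)$ is the $s$-th largest singular value. $f:\mathbb{R}^n\to\mathbb{R}$ is locally Lipschitz continuous and differentiable. $c:\mathbb{R}^n\to\mathbb{R}^p$ is differentiable and its transposed Jacobian $J_c(x)\in\mathbb{R}^{n\times p}$ (entries $(J_c(x))_{ij}=\partial c_j/\partial x_i$) is locally Lipschitz continuous. $\mathcal{M}:=\{x\in\mathbb{R}^n:c(x)=0\}$. There are an integer $1\le p'\le p$ and a neighborhood $\mathcal{X}$ of $\mathcal{M}$ such that $\operatorname{rank}J_c(x)=p'$ for all $x\in\mathcal{X}$ (relaxed constant rank constraint qualification). $\mathcal{A}:\mathbb{R}^n\to\mathbb{R}^n$ is differentiable with locally Lipschitz transposed Jacobian $J_{\mathcal{A}}(x)\in\mathbb{R}^{n\times n}$ (entries $\partial\mathcal{A}_j/\partial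 x_i$), $\mathcal{A}(x)=x$ for all $x\in\mathcal{M}$, and $J_{\mathcal{A}}(x)J_c(x)=0$ for all $x\in\mathcal{M}$. $\nabla f(\mathcal{A}(y))$ means $\nabla f(z)|_{z=\mathcal{A}(y)}$, and $\mathcal{A}^2(y)=\mathcal{A}(\mathcal{A}(y))$. **Constants.** For $x\in\mathcal{M}$, let $\rho_x$ be the largest $\rho\in(0,1]$ such that the open ball $\mathcal{B}_{x,\rho}$ of center $x$ and radius $\rho$ is contained in $\mathcal{X}$ and $\inf\{\sigma_{p'}(J_c(y)):y\in\mathcal{B}_{x,\rho}\}\ge\frac12\sigma_{p'}(J_c(x))$. Let $\Theta_x:=\{y:\|y-x\|\le\rho_x\}$ and $\sigma_{x,c}:=\sigma_{p'}(J_c(x))$; $M_{x,c}:=\sup_{y\in\Theta_x}\|J_c(y)\|$; $M_{x,A}:=\sup_{y\in\Theta_x}\|J_{\mathcal{A}}(y)\|$; and let $L_{x,c}$, $L_{x,A}$, $L_{x,b}$ be the suprema over $y\ne z$ in $\Theta_x$ of, respectively, $\frac{\|J_c(y)-J_c(z)\|}{\|y-z\|}$, $\frac{\|J_{\mathcal{A}}(y)-J_{\mathcal{A}}(z)\|}{\|y-z\|}$, $\frac{\|J_{\mathcal{A}}(y)J_c(\mathcal{A}(y))-J_{\mathcal{A}}(z)J_c(\mathcal{A}(z))\|}{\|y-z\|}$. Set $$\varepsilon_x:=\min\Big\{\frac{\rho_x}{2},\ \frac{\sigma_{x,c}}{32L_{x,c}(M_{x,A}+1)},\ \frac{\sigma_{x,c}^2}{8(L_{x,b}+L_{x,c})M_{x,c}},\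 \frac{\sigma_{x,c}}{5(L_{x,b}+L_{x,A}M_{x,c})}\Big\}$$ (a fraction with zero denominator is read as $+\infty$), and $\Omega_x:=\{y\in\mathbb{R}^n:\|y-x\|\le\varepsilon_x\}$. **Threshold.** $$\tilde\beta_x:=\sup_{y\in\Omega_x}\max\Big\{\frac{2(f(\mathcal{A}^2(y))-f(\mathcal{A}(y)))}{\|c(y)\|^2-\|c(\mathcal{A}(y))\|^2},\ \frac{(\mathcal{A}(y)-y)^\top J_{\mathcal{A}}(y)\nabla f(\mathcal{A}(y))}{(y-\mathcal{A}(y))^\top J_c(y)c(y)},\ 0\Big\},$$ with the convention $0/0:=0$ (which occurs for $y\in\mathcal{M}$). **Stationarity.** $y$ is a first-order stationary point of the constrained problem if $c(y)=0$ and there is $\tilde\lambda\in\mathbb{R}^p$ with $\nabla f(y)-\sum_{i=1}^p\tilde\lambda_i\nabla c_i(y)=0$. It is a second-order stationary point of the constrained problem if it is a first-order stationary point and $d^\top\big(\nabla^2f(y)-\sum_{i=1}^p\lambda_i(y)\nabla^2c_i(y)\big)d\ge0$ for every $d\in\mathcal{T}_y:=\{d\in\mathbb{R}^n:d^\top J_c(y)=0\}$, where $\lambda(y):=J_c(y)^\dagger\nabla f(y)$ and $\dagger$ denotes the Moore–Penrose pseudo-inverse. $y$ is a second-order stationary point of $h$ if $\nabla h(y)=0$ and $\nabla^2h(y)\succeq0$. *)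

theory Defs
  imports "HOL-Analysis.Analysis"
begin

section \<open>Derivatives\<close>

definition grad :: "(real^'n \<Rightarrow> real) \<Rightarrow> real^'n \<Rightarrow> real^'n" where
  "grad f x = (\<chi> i. frechet_derivative f (at x) (axis i 1))"

definition hess :: "(real^'n \<Rightarrow> real) \<Rightarrow> real^'n \<Rightarrow> real^'n^'n" where
  "hess f x = jacobian (grad f) (at x)"

text \<open>Transposed Jacobian: the entry in row \<open>i\<close> and column \<open>j\<close> is the \<open>i\<close>-th partial
  derivative of the \<open>j\<close>-th component of \<open>c\<close>.\<close>

definition tjac :: "(real^'n \<Rightarrow> real^'p) \<Rightarrow> real^'n \<Rightarrow> real^'p^'n" where
  "tjac c x = transpose (jacobian c (at x))"

definition twice_differentiable :: "('a::real_normed_vector \<Rightarrow> 'b::real_normed_vector) \<Rightarrow> bool" where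
  "twice_differentiable g \<longleftrightarrow>
     (\<exists>D :: 'a \<Rightarrow> ('a \<Rightarrow>\<^sub>L 'b). \<forall>x. (g has_derivative blinfun_apply (D x)) (at x)
                                \<and> D differentiable (at x))"

section \<open>Spectral norm, singular values, pseudo-inverse\<close>

text \<open>The library norm on \<open>real^'m^'n\<close> is the Frobenius norm, hence the separate definition.\<close>

definition spectral_norm :: "real^'m^'n \<Rightarrow> real" where
  "spectral_norm M = onorm ((*v) M)"

definition singular_values :: "real^'m^'n \<Rightarrow> real set" where
  "singular_values M = {s. 0 \<le> s \<and> (\<exists>v. v \<noteq> 0 \<and> (transpose M ** M) *v v = s\<^sup>2 *\<^sub>R v)}"

definition sv_mult :: "real^'m^'n \<Rightarrow> real \<Rightarrow> nat" where
  "sv_mult M s = dim {v. (transpose M ** M) *v v = s\<^sup>2 *\<^sub>R v}"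

text \<open>The \<open>k\<close>-th largest singular value, counted with multiplicity (\<open>k = 1\<close> is the largest):
  the largest singular value \<open>t\<close> such that at least \<open>k\<close> singular values are \<open>\<ge> t\<close>.
  Since \<open>transpose M ** M\<close> has one eigenvalue per column of \<open>M\<close>, this is meaningful for \<open>k\<close>
  from 1 to the number of columns; if there are more columns than rows, the surplus values are 0.\<close>

definition sigma :: "nat \<Rightarrow> real^'m^'n \<Rightarrow> real" where
  "sigma k M = Max {t \<in> singular_values M.
                     k \<le> (\<Sum>s \<in> {s \<in> singular_values M. t \<le> s}. sv_mult M s)}"

text \<open>Moore-Penrose pseudo-inverse, by the four Penrose conditions.\<close>

definition pinv :: "real^'m^'n \<Rightarrow> real^'n^'m" where
  "pinv M = (THE P. M ** P ** M = M \<and> P ** M ** P = P \<and>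
                    transpose (M ** P) = M ** P \<and> transpose (P ** M) = P ** M)"

text \<open>Local Lipschitz continuity where differences of values are measured by \<open>N\<close>
  (the norm for vectors, the spectral norm for matrices).\<close>

definition locally_lipschitz ::
  "('b \<Rightarrow> real) \<Rightarrow> ('a::metric_space \<Rightarrow> 'b::minus) \<Rightarrow> bool" where
  "locally_lipschitz N g \<longleftrightarrow>
     (\<forall>x. \<exists>e>0. \<exists>L. \<forall>y \<in> ball x e. \<forall>z \<in> ball x e. N (g y - g z) \<le> L * dist y z)"

section \<open>Constants\<close>

definition rho ::
  "nat \<Rightarrow> (real^'n) set \<Rightarrow> (real^'n \<Rightarrow> real^'p) \<Rightarrow> real^'n \<Rightarrow> real" where
  "rho p' X c x = (GREATEST r. 0 < r \<and> r \<le> 1 \<and> ball x r \<subseteq> X \<and>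
       (INF y \<in> ball x r. sigma p' (tjac c y)) \<ge> 1/2 * sigma p' (tjac c x))"

definition sup_norm_on :: "'a set \<Rightarrow> ('a \<Rightarrow> real^'m^'k) \<Rightarrow> real" where
  "sup_norm_on S G = (SUP y \<in> S. spectral_norm (G y))"

definition lip_const :: "(real^'n) set \<Rightarrow> (real^'n \<Rightarrow> real^'m^'k) \<Rightarrow> real" where
  "lip_const S G = (SUP (y, z) \<in> {(y, z). y \<in> S \<and> z \<in> S \<and> y \<noteq> z}.
                      spectral_norm (G y - G z) / norm (y - z))"

text \<open>Quotient that is read as \<open>\<infinity>\<close> when the denominator vanishes.\<close>

definition quot_inf :: "real \<Rightarrow> real \<Rightarrow> ereal" where
  "quot_inf a b = (if b = 0 then \<infinity> else ereal (a / b))"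

definition eps ::
  "nat \<Rightarrow> (real^'n) set \<Rightarrow> (real^'n \<Rightarrow> real^'p) \<Rightarrow> (real^'n \<Rightarrow> real^'n) \<Rightarrow> real^'n \<Rightarrow> ereal" where
  "eps p' X c A x =
     (let r = rho p' X c x; \<Theta> = {y. norm (y - x) \<le> r};
          \<sigma> = sigma p' (tjac c x);
          Mc = sup_norm_on \<Theta> (tjac c);
          MA = sup_norm_on \<Theta> (tjac A);
          Lc = lip_const \<Theta> (tjac c);
          LA = lip_const \<Theta> (tjac A);
          Lb = lip_const \<Theta> (\<lambda>y. tjac A y ** tjac c (A y))
      in Min {ereal (r / 2),
              quot_inf \<sigma> (32 * Lc * (MA + 1)),
              quot_inf (\<sigma>\<^sup>2) (8 * (Lb + Lc) * Mc),
              quot_inf \<sigma> (5 * (Lb + LA * Mc))})"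

definition Omega ::
  "nat \<Rightarrow> (real^'n) set \<Rightarrow> (real^'n \<Rightarrow> real^'p) \<Rightarrow> (real^'n \<Rightarrow> real^'n) \<Rightarrow> real^'n \<Rightarrow> (real^'n) set" where
  "Omega p' X c A x = {y. ereal (norm (y - x)) \<le> eps p' X c A x}"

text \<open>Quotient with \<open>0/0 = 0\<close>. A nonzero numerator over 0 gives \<open>\<plusminus>\<infinity>\<close>, unlike
  real division, which would give 0.\<close>

definition quot_zero :: "real \<Rightarrow> real \<Rightarrow> ereal" where
  "quot_zero a b = (if a = 0 \<and> b = 0 then 0 else ereal a / ereal b)"

text \<open>The supremum is taken in the extended reals, so that it is the true supremum whether or
  not the set is bounded.\<close>

definition beta_tilde ::
  "nat \<Rightarrow> (real^'n) set \<Rightarrow> (real^'n \<Rightarrow> real) \<Rightarrow> (real^'n \<Rightarrow> real^'p) \<Rightarrow> (real^'n \<Rightarrow> real^'n) \<Rightarrow>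
   real^'n \<Rightarrow> ereal" where
  "beta_tilde p' X f c A x =
     (SUP y \<in> Omega p' X c A x. Max {
        quot_zero (2 * (f (A (A y)) - f (A y))) ((norm (c y))\<^sup>2 - (norm (c (A y)))\<^sup>2),
        quot_zero ((A y - y) \<bullet> (tjac A y *v grad f (A y))) ((y - A y) \<bullet> (tjac c y *v c y)),
        0})"

section \<open>Stationarity\<close>

definition fosp_constrained ::
  "(real^'n \<Rightarrow> real) \<Rightarrow> (real^'n \<Rightarrow> real^'p) \<Rightarrow> real^'n \<Rightarrow> bool" where
  "fosp_constrained f c y \<longleftrightarrow> c y = 0 \<and>
     (\<exists>l :: real^'p. grad f y - (\<Sum>i\<in>UNIV. l $ i *\<^sub>R grad (\<lambda>z. c z $ i) y) = 0)"

definition sosp_constrained ::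
  "(real^'n \<Rightarrow> real) \<Rightarrow> (real^'n \<Rightarrow> real^'p) \<Rightarrow> real^'n \<Rightarrow> bool" where
  "sosp_constrained f c y \<longleftrightarrow> fosp_constrained f c y \<and>
     (let l = pinv (tjac c y) *v grad f y in
      \<forall>d. d v* tjac c y = 0 \<longrightarrow>
          d \<bullet> ((hess f y - (\<Sum>i\<in>UNIV. l $ i *\<^sub>R hess (\<lambda>z. c z $ i) y)) *v d) \<ge> 0)"

definition sosp_unconstrained :: "(real^'n \<Rightarrow> real) \<Rightarrow> real^'n \<Rightarrow> bool" where
  "sosp_unconstrained h y \<longleftrightarrow> grad h y = 0 \<and> (\<forall>d. d \<bullet> (hess h y *v d) \<ge> 0)"

end

theory Submission
  imports Defs
begin

text \<open>The penalty function is \<open>h = f \<circ> A + \<beta>/2 \<parallel>c\<parallel>\<^sup>2\<close>. Write \<open>D\<close> for derivatives, so that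
\<open>D c y\<close> is the transpose of \<open>tjac c y\<close>, and let \<open>M\<close> be the feasible set. The proof has three
ingredients.

\<^bold>\<open>Constant rank gives an error bound.\<close> Near a feasible \<open>x\<close>, let \<open>S\<close> be the pseudo-inverse of
\<open>D c x\<close> and \<open>\<Phi> y = (y - x) + S (c y - D c x (y - x))\<close>. This is a small perturbation of the identity
that keeps the component of \<open>y - x\<close> in the kernel of \<open>D c x\<close> and replaces the orthogonal one by
\<open>S (c y)\<close>. The points with \<open>\<Phi> z = s w\<close> for \<open>w\<close> in that kernel form a curve on which \<open>S \<circ> c\<close>
vanishes; by constant rank \<open>c\<close> itself cannot change on it, so it consists of feasible points. Ending
the curve at the kernel component of \<open>\<Phi> y\<close> produces a feasible point at distance at most a constant
times \<open>\<parallel>c y\<parallel>\<close> from \<open>y\<close> (\<open>nearby_zero\<close>). In particular every \<open>d\<close> in the kernel of \<open>D c y\<close> is the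
velocity of a curve in \<open>M\<close> (\<open>tangent_derivative_zero\<close>), so identities valid on \<open>M\<close>, such as
\<open>A z = z\<close> and \<open>tjac A z ** tjac c z = 0\<close>, may be differentiated along \<open>d\<close>. It follows that \<open>D A y\<close> is
a projection onto the kernel of \<open>D c y\<close>.

\<^bold>\<open>The threshold excludes infeasible stationary points.\<close> With the error bound, the radius of
\<open>Omega\<close> is small enough that \<open>(y - A y) \<bullet> (tjac c y *v c y) > 0\<close> at every infeasible \<open>y\<close> in it
(\<open>inner_dissolving_direction_pos\<close>). The second quotient in the threshold then bounds the slope of
\<open>f \<circ> A\<close> in direction \<open>A y - y\<close> strictly by \<open>\<beta>\<close> times this number, which contradicts
\<open>grad h y = 0\<close> (\<open>stationary_imp_feasible\<close>). At feasible \<open>y\<close> both notions of first-order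
stationarity say that the gradient of \<open>f\<close> is orthogonal to the kernel of \<open>D c y\<close>.

\<^bold>\<open>The Hessian of h splits along the projection.\<close> At a feasible stationary \<open>y\<close> write \<open>d = u + w\<close>
with \<open>u = D A y d\<close> tangent and \<open>w\<close> in the kernel of \<open>D A y\<close>. Differentiating
\<open>tjac A z *v (tjac c z *v \<lambda>) = 0\<close> along \<open>u\<close> shows that the Hessian acts on \<open>u\<close> as the Hessian of the
Lagrangian followed by \<open>tjac A y\<close> (\<open>tangent_curvature\<close>); hence the mixed terms vanish and the tangential
part is the quadratic form of the constrained second-order condition. In the direction \<open>w\<close> the form is
nonnegative in any case: it is the second-order limit of the threshold inequality at points
approaching \<open>y\<close> along \<open>w\<close> inside \<open>Omega\<close> (\<open>normal_curvature\<close>).\<close>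

section \<open>Singular values of matrices of known rank\<close>

lemma inner_matrix_vector_adjoint:
  fixes M :: "real^'m^'n"
  shows "(M *v v) \<bullet> u = v \<bullet> (u v* M)"
  by (metis dot_lmul_matrix inner_commute)

lemma gram_mult: 
  fixes M :: "real^'m^'n"
  shows "(transpose M ** M) *v v = (M *v v) v* M"
  by (metis matrix_vector_mul_assoc transpose_matrix_vector)

lemma gram_inner:
  fixes M :: "real^'m^'n"
  shows "v \<bullet> ((transpose M ** M) *v u) = (M *v v) \<bullet> (M *v u)"
  by (simp only: gram_mult inner_matrix_vector_adjoint)

lemma gram_symmetric:
  fixes M :: "real^'m^'n"
  shows "((transpose M ** M) *v u) \<bullet> v = u \<bullet> ((transpose M ** M) *v v)"
  by (subst inner_commute) (simp only: gram_inner inner_commute)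

lemma gram_eq_0_iff:
  fixes M :: "real^'m^'n"
  shows "(transpose M ** M) *v v = 0 \<longleftrightarrow> M *v v = 0"
  by (metis gram_inner gram_mult inner_eq_zero_iff inner_zero_right vector_matrix_mult_0)

lemma orthogonal_zero_imp_span_UNIV:
  fixes S :: "'a::euclidean_space set"
  assumes "\<And>a. (\<And>s. s \<in> S \<Longrightarrow> a \<bullet> s = 0) \<Longrightarrow> a = 0"
  shows "span S = UNIV"
proof (rule ccontr)
  assume "span S \<noteq> UNIV"
  then obtain a where "a \<noteq> 0" "\<forall>x\<in>span S. a \<bullet> x = 0"
    using span_not_UNIV_orthogonal by blast
  with assms[of a] show False by (auto simp: span_base)
qed

lemma rank_nullity:
  fixes M :: "real^'m^'n"
  shows "dim {v. M *v v = 0} + rank M = CARD('m)"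
proof -
  let ?K = "{v. M *v v = 0}" and ?R = "range (\<lambda>u. u v* M)"
  have "dim (?R \<union> ?K) = dim ?R + dim ?K"
    by (rule dim_orthogonal_sum) (auto simp: dot_lmul_matrix)
  moreover have "span (?R \<union> ?K) = UNIV"
  proof (rule orthogonal_zero_imp_span_UNIV)
    fix a assume a: "\<And>s. s \<in> ?R \<union> ?K \<Longrightarrow> a \<bullet> s = 0"
    have "(M *v a) \<bullet> (M *v a) = a \<bullet> ((M *v a) v* M)"
      by (rule inner_matrix_vector_adjoint)
    then have "M *v a = 0" using a by auto
    then show "a = 0" using a[of a] by auto
  qed
  then have "dim (?R \<union> ?K) = CARD('m)"
    using dim_span[of "?R \<union> ?K"] by simp
  moreover have "dim ?R = rank M"
    using rank_dim_range[of "transpose M"] by (simp add: rank_transpose)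
  ultimately show ?thesis by simp
qed

text \<open>A minimizer \<open>v\<close> of \<open>w \<bullet> T w\<close> on the unit sphere of \<open>W\<close> is an eigenvector: the residual
\<open>r = T v - \<mu> v\<close> lies in \<open>W\<close> again, and moving from \<open>v\<close> a small step along \<open>- r\<close> would decrease
the quotient unless \<open>r = 0\<close>. Applied to orthogonal complements of eigenspaces, this
yields the spectral decomposition of \<open>T\<close>.\<close>

lemma min_rayleigh_eigenvector:
  fixes T :: "'a::euclidean_space \<Rightarrow> 'a"
  assumes T: "linear T" and sym: "\<And>u v. T u \<bullet> v = u \<bullet> T v"
    and W: "subspace W" and inv: "\<And>w. w \<in> W \<Longrightarrow> T w \<in> W" and nz: "w0 \<in> W" "w0 \<noteq> 0"
  shows "\<exists>v mu. v \<in> W \<and> norm v = 1 \<and> T v = mu *\<^sub>R v \<and>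
    (\<forall>w\<in>W. mu * (norm w)\<^sup>2 \<le> w \<bullet> T w)"
proof -
  let ?S = "W \<inter> sphere 0 1"
  have "compact ?S"
    by (simp add: closed_Int_compact closed_subspace W)
  moreover have "(1 / norm w0) *\<^sub>R w0 \<in> ?S" 
    using nz W by (simp add: subspace_scale)
  then have "?S \<noteq> {}" by blast
  moreover have "continuous_on ?S (\<lambda>w. w \<bullet> T w)"
    by (intro continuous_intros linear_continuous_on linear_conv_bounded_linear[THEN iffD1] T)
  ultimately obtain v where v: "v \<in> ?S" "\<forall>w\<in>?S. v \<bullet> T v \<le> w \<bullet> T w"
    using continuous_attains_inf by blast
  define mu where "mu = v \<bullet> T v"
  have ge: "mu * (norm w)\<^sup>2 \<le> w \<bullet> T w" if "w \<in> W" for w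
  proof (cases "w = 0")
    case False
    have "(1 / norm w) *\<^sub>R w \<in> ?S" using that False W by (simp add: subspace_scale)
    then have "mu \<le> ((1 / norm w) *\<^sub>R w) \<bullet> T ((1 / norm w) *\<^sub>R w)"
      unfolding mu_def using v(2) by blast
    also have "\<dots> = (w \<bullet> T w) / (norm w)\<^sup>2"
      by (simp add: linear_cmul[OF T] power2_eq_square)
    finally show ?thesis using False by (simp add: field_simps)
  qed (simp add: linear_0[OF T])
  define r where "r = T v - mu *\<^sub>R v"
  have vW: "v \<in> W" and nv: "norm v = 1" using v by auto
  have rW: "r \<in> W" unfolding r_def using vW inv W by (simp add: subspace_diff subspace_scale)
  have Q: "0 \<le> 2 * t * (r \<bullet> r) + t\<^sup>2 * (r \<bullet> T r - mu * (r \<bullet> r))" for t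
  proof -
    have "v + t *\<^sub>R r \<in> W" using vW rW W by (simp add: subspace_add subspace_scale)
    from ge[OF this] have "mu * ((v + t *\<^sub>R r) \<bullet> (v + t *\<^sub>R r)) \<le> (v + t *\<^sub>R r) \<bullet> T (v + t *\<^sub>R r)"
      by (simp add: power2_norm_eq_inner)
    moreover have "v \<bullet> v = 1" using nv by (simp add: norm_eq_1)
    moreover have "v \<bullet> T r = r \<bullet> T v" by (metis sym inner_commute)
    moreover have rv: "r \<bullet> v = 0"
      using \<open>v \<bullet> v = 1\<close> by (simp add: r_def inner_diff_left inner_diff_right mu_def inner_commute)
    moreover have "r \<bullet> T v = r \<bullet> r"
      using rv by (simp add: r_def inner_diff_right)
    ultimately show ?thesis
      by (simp add: linear_add[OF T] linear_cmul[OF T] inner_add inner_commute[of v r]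
          mu_def[symmetric] algebra_simps power2_eq_square)
  qed
  have "r \<bullet> r = 0"
  proof (rule ccontr)
    assume "r \<bullet> r \<noteq> 0"
    then have b: "r \<bullet> r > 0" by simp
    define a where "a = r \<bullet> T r - mu * (r \<bullet> r)"
    define t where "t = - (r \<bullet> r) / (\<bar>a\<bar> + 1)"
    have t: "t < 0" unfolding t_def using b by (simp add: divide_neg_pos)
    have "0 \<le> t * (2 * (r \<bullet> r) + t * a)" using Q[of t] by (simp add: a_def power2_eq_square algebra_simps)
    with t have "2 * (r \<bullet> r) \<le> - t * a" by (simp add: zero_le_mult_iff)
    also have "\<dots> \<le> - t * (\<bar>a\<bar> + 1)" using t by (intro mult_left_mono) auto
    also have "\<dots> = r \<bullet> r" by (simp add: t_def)
    finally show False using b by simp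
  qed
  then have "T v = mu *\<^sub>R v" by (simp add: r_def)
  with vW nv ge show ?thesis by blast
qed

lemma singular_eigenspaces_orthogonal:
  fixes M :: "real^'m^'n"
  assumes "(transpose M ** M) *v u = s\<^sup>2 *\<^sub>R u" "(transpose M ** M) *v v = t\<^sup>2 *\<^sub>R v"
    and "0 \<le> s" "0 \<le> t" "s \<noteq> t"
  shows "u \<bullet> v = 0"
proof -
  have "s\<^sup>2 * (u \<bullet> v) = t\<^sup>2 * (u \<bullet> v)"
    using gram_inner[of u M v] gram_inner[of v M u] assms(1,2) by (simp add: inner_commute)
  moreover have "s\<^sup>2 \<noteq> t\<^sup>2" using assms by (simp add: power2_eq_iff_nonneg)
  ultimately show ?thesis by simp
qed

lemma finite_singular_values:
  fixes M :: "real^'m^'n"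
  shows "finite (singular_values M)"
proof -
  define e where "e s = (SOME v. v \<noteq> 0 \<and> (transpose M ** M) *v v = s\<^sup>2 *\<^sub>R v)" for s
  have e: "e s \<noteq> 0 \<and> (transpose M ** M) *v e s = s\<^sup>2 *\<^sub>R e s" if "s \<in> singular_values M" for s
    unfolding e_def by (rule someI_ex) (use that in \<open>simp add: singular_values_def\<close>)
  have nn: "0 \<le> s" if "s \<in> singular_values M" for s
    using that by (simp add: singular_values_def)
  have orth: "e s \<bullet> e t = 0" if "s \<in> singular_values M" "t \<in> singular_values M" "s \<noteq> t" for s t
    using e nn that singular_eigenspaces_orthogonal by blast
  have "pairwise orthogonal (e ` singular_values M)"
    unfolding pairwise_image by (auto simp: pairwise_def orthogonal_def orth)
  then have "finite (e ` singular_values M)"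
    using e by (intro pairwise_orthogonal_imp_finite) auto
  moreover have "inj_on e (singular_values M)"
  proof (rule inj_onI, rule ccontr)
    fix s t assume st: "s \<in> singular_values M" "t \<in> singular_values M" "e s = e t" "s \<noteq> t"
    then have "e s \<bullet> e s = 0" using orth[of s t] by simp
    with e[OF st(1)] show False by simp
  qed
  ultimately show ?thesis by (rule finite_imageD)
qed

lemma dim_UN_orthogonal:
  fixes E :: "'i \<Rightarrow> 'a::euclidean_space set"
  assumes "finite I"
    and "\<And>i j u v. \<lbrakk>i \<in> I; j \<in> I; i \<noteq> j; u \<in> E i; v \<in> E j\<rbrakk> \<Longrightarrow> u \<bullet> v = 0"
  shows "dim (\<Union>i\<in>I. E i) = (\<Sum>i\<in>I. dim (E i))"
  using assms
proof (induction I rule: finite_induct)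
  case (insert i I)
  have "dim (E i \<union> (\<Union>j\<in>I. E j)) = dim (E i) + dim (\<Union>j\<in>I. E j)"
  proof (rule dim_orthogonal_sum)
    fix u v assume u: "u \<in> E i" and "v \<in> (\<Union>j\<in>I. E j)"
    then obtain j where "j \<in> I" "v \<in> E j" by blast
    with u insert.hyps show "u \<bullet> v = 0" by (intro insert.prems[of i j]) auto
  qed
  also have "dim (\<Union>j\<in>I. E j) = (\<Sum>j\<in>I. dim (E j))"
  proof (rule insert.IH)
    fix j k u v assume "j \<in> I" "k \<in> I" "j \<noteq> k" "u \<in> E j" "v \<in> E k"
    then show "u \<bullet> v = 0" by (intro insert.prems[of j k]) auto
  qed
  finally show ?case using insert.hyps by simp
qed simp

text \<open>The eigenspaces of \<open>transpose M ** M\<close> to positive eigenvalues together with the kernel of \<open>M\<close> span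
the whole space, since an eigenvector in their orthogonal complement would belong to one of them.
Counting dimensions and removing the kernel leaves the rank.\<close>

lemma sum_positive_sv_mult:
  fixes M :: "real^'m^'n"
  shows "(\<Sum>s\<in>{s \<in> singular_values M. 0 < s}. sv_mult M s) = rank M"
proof -
  let ?T = "\<lambda>v. (transpose M ** M) *v v" and ?P = "{s \<in> singular_values M. 0 < s}"
    and ?K = "{v. M *v v = 0}"
  let ?E = "\<lambda>s. {v. ?T v = s\<^sup>2 *\<^sub>R v}"
  let ?U = "\<Union>s\<in>?P. ?E s"
  have EK: "u \<bullet> v = 0" if uv: "u \<in> ?U" "v \<in> ?K" for u v
  proof -
    obtain s where s: "0 < s" "?T u = s\<^sup>2 *\<^sub>R u"
      using uv(1) by (elim UN_E CollectE conjE) (rule that)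
    have "?T v = 0\<^sup>2 *\<^sub>R v" using uv(2) by (simp add: gram_eq_0_iff)
    then show ?thesis using singular_eigenspaces_orthogonal[of M u s v 0] s by auto
  qed
  have span: "span (?U \<union> ?K) = UNIV"
  proof (rule orthogonal_zero_imp_span_UNIV, rule ccontr)
    fix a assume a: "\<And>s. s \<in> ?U \<union> ?K \<Longrightarrow> a \<bullet> s = 0" "a \<noteq> 0"
    define W where "W = {a. \<forall>s \<in> ?U \<union> ?K. s \<bullet> a = 0}"
    have sub: "subspace W" unfolding W_def by (simp add: subspace_def inner_add_right)
    have inv: "?T w \<in> W" if w: "w \<in> W" for w
      unfolding W_def
    proof (rule CollectI, rule ballI)
      fix s assume s: "s \<in> ?U \<union> ?K"
      have "s \<bullet> ?T w = ?T s \<bullet> w" by (metis gram_inner inner_commute)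
      also have "\<exists>k. ?T s = k *\<^sub>R s"
      proof (cases "s \<in> ?K")
        case True then show ?thesis by (intro exI[of _ 0]) (simp add: gram_eq_0_iff)
      next
        case False with s show ?thesis by auto
      qed
      then have "?T s \<bullet> w = 0" using w s unfolding W_def by auto
      finally show "s \<bullet> ?T w = 0" .
    qed
    have "a \<in> W" unfolding W_def using a(1) by (auto simp: inner_commute)
    obtain v mu where v: "v \<in> W" "norm v = 1" "?T v = mu *\<^sub>R v"
      using min_rayleigh_eigenvector
          [OF matrix_vector_mul_linear gram_symmetric sub inv \<open>a \<in> W\<close> a(2)] by blast
    have "mu = v \<bullet> ?T v" using v by (simp add: norm_eq_1)
    also have "\<dots> = (M *v v) \<bullet> (M *v v)" by (rule gram_inner)
    finally have mu: "mu = (M *v v) \<bullet> (M *v v)" .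
    have "v \<in> ?U \<union> ?K"
    proof (cases "mu = 0")
      case True then show ?thesis using mu by simp
    next
      case False
      then have "0 < sqrt mu" "(sqrt mu)\<^sup>2 = mu" using mu by auto
      moreover have "v \<noteq> 0" using v by auto
      ultimately have "sqrt mu \<in> ?P" "v \<in> ?E (sqrt mu)" using v unfolding singular_values_def by (simp_all, blast)
      then have "v \<in> ?U" by (rule UN_I)
      then show ?thesis by (rule UnI1)
    qed
    with v(1) have "v \<bullet> v = 0" unfolding W_def by blast
    with v(2) show False by simp
  qed
  have "CARD('m) = dim (?U \<union> ?K)"
    using arg_cong[OF span, of dim] by simp
  also have "\<dots> = dim ?U + dim ?K" by (rule dim_orthogonal_sum) (rule EK)
  also have "dim ?U = (\<Sum>s\<in>?P. sv_mult M s)"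
    unfolding sv_mult_def
  proof (rule dim_UN_orthogonal)
    fix s t u v assume st: "s \<in> ?P" "t \<in> ?P" "s \<noteq> t" and uv: "u \<in> ?E s" "v \<in> ?E t"
    show "u \<bullet> v = 0"
      by (rule singular_eigenspaces_orthogonal[of M u s v t]) (use st uv in auto)
  qed (simp add: finite_singular_values)
  finally show ?thesis using rank_nullity[of M] by simp
qed

lemma sv_mult_pos:
  fixes M :: "real^'m^'n"
  assumes "s \<in> singular_values M"
  shows "0 < sv_mult M s"
proof -
  obtain v where "v \<noteq> 0" "v \<in> {v. (transpose M ** M) *v v = s\<^sup>2 *\<^sub>R v}"
    using assms by (auto simp: singular_values_def)
  then have "\<not> {v. (transpose M ** M) *v v = s\<^sup>2 *\<^sub>R v} \<subseteq> {0}" by blast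
  then show ?thesis unfolding sv_mult_def dim_eq_0[symmetric] by (rule neq0_conv[THEN iffD1])
qed

text \<open>For a matrix of rank \<open>r\<close> exactly \<open>r\<close> singular values, counted with multiplicity, are positive, so
the \<open>r\<close>-th largest is the least positive one.\<close>

lemma sigma_rank_least:
  fixes M :: "real^'m^'n"
  assumes "1 \<le> rank M"
  shows "sigma (rank M) M \<in> singular_values M" and "0 < sigma (rank M) M"
    and "\<And>s. s \<in> singular_values M \<Longrightarrow> 0 < s \<Longrightarrow> sigma (rank M) M \<le> s"
proof -
  let ?P = "{s \<in> singular_values M. 0 < s}"
  let ?C = "{t \<in> singular_values M. rank M \<le> (\<Sum>s \<in> {s \<in> singular_values M. t \<le> s}. sv_mult M s)}"
  have fP: "finite ?P" and nP: "?P \<noteq> {}"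
    using sum_positive_sv_mult[of M] assms finite_singular_values[of M] by fastforce+
  define s0 where "s0 = Min ?P"
  have s0: "s0 \<in> ?P" "\<And>s. s \<in> ?P \<Longrightarrow> s0 \<le> s"
    unfolding s0_def using Min_in[OF fP nP] Min_le[OF fP] by auto
  have "{s \<in> singular_values M. s0 \<le> s} = ?P" using s0 by force
  then have "s0 \<in> ?C" using s0 sum_positive_sv_mult[of M] by simp
  moreover have "t \<le> s0" if t: "t \<in> ?C" for t
  proof (rule ccontr)
    assume "\<not> t \<le> s0"
    then have "{s \<in> singular_values M. t \<le> s} \<subseteq> ?P - {s0}" using s0(1) by auto
    then have "(\<Sum>s \<in> {s \<in> singular_values M. t \<le> s}. sv_mult M s) \<le> (\<Sum>s \<in> ?P - {s0}. sv_mult M s)"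
      using fP by (intro sum_mono2) auto
    also have "\<dots> < (\<Sum>s \<in> ?P. sv_mult M s)"
      using sum.remove[OF fP s0(1), of "sv_mult M"] sv_mult_pos[of s0 M] s0(1) by simp
    also have "\<dots> = rank M" by (rule sum_positive_sv_mult)
    finally show False using t by simp
  qed
  moreover have "finite ?C" using finite_singular_values[of M] by simp
  ultimately have "sigma (rank M) M = s0"
    unfolding sigma_def by (intro Max_eqI) auto
  with s0 show "sigma (rank M) M \<in> singular_values M" "0 < sigma (rank M) M"
    "\<And>s. s \<in> singular_values M \<Longrightarrow> 0 < s \<Longrightarrow> sigma (rank M) M \<le> s" by auto
qed

text \<open>On the complement of the kernel the minimum of \<open>\<parallel>M *v v\<parallel> / \<parallel>v\<parallel>\<close> is attained at an eigenvector of
\<open>transpose M ** M\<close>, hence is itself a positive singular value.\<close>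

lemma sigma_rank_lower_bound:
  fixes M :: "real^'m^'n"
  assumes r: "1 \<le> rank M" and v: "\<And>k. M *v k = 0 \<Longrightarrow> v \<bullet> k = 0"
  shows "sigma (rank M) M * norm v \<le> norm (M *v v)"
proof (cases "v = 0")
  case False
  let ?T = "\<lambda>v. (transpose M ** M) *v v"
  define W where "W = {a. \<forall>k \<in> {k. M *v k = 0}. k \<bullet> a = 0}"
  have sub: "subspace W" unfolding W_def by (simp add: subspace_def inner_add_right)
  have inv: "?T w \<in> W" for w
    unfolding W_def by (simp add: gram_inner)
  have "v \<in> W" unfolding W_def using v by (auto simp: inner_commute)
  obtain e mu where e: "e \<in> W" "norm e = 1" "?T e = mu *\<^sub>R e"
    and ge: "\<And>w. w \<in> W \<Longrightarrow> mu * (norm w)\<^sup>2 \<le> w \<bullet> ?T w"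
    using min_rayleigh_eigenvector
        [OF matrix_vector_mul_linear gram_symmetric sub inv \<open>v \<in> W\<close> False] by blast
  have "mu = e \<bullet> ?T e" using e by (simp add: norm_eq_1)
  also have "\<dots> = (M *v e) \<bullet> (M *v e)" by (rule gram_inner)
  finally have mu: "mu = (M *v e) \<bullet> (M *v e)" .
  have "M *v e \<noteq> 0"
  proof
    assume "M *v e = 0"
    then have "e \<bullet> e = 0" using e(1) unfolding W_def by blast
    with e(2) show False by simp
  qed
  then have "0 < sqrt mu" "(sqrt mu)\<^sup>2 = mu" using mu by auto
  moreover have "e \<noteq> 0" using e by auto
  ultimately have "sqrt mu \<in> singular_values M" using e unfolding singular_values_def by auto
  then have "sigma (rank M) M \<le> sqrt mu" using sigma_rank_least(3)[OF r] \<open>0 < sqrt mu\<close> by blast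
  then have "sigma (rank M) M * norm v \<le> sqrt mu * norm v" by (intro mult_right_mono) auto
  also have "\<dots> = sqrt (mu * (norm v)\<^sup>2)" by (simp add: real_sqrt_mult)
  also have "\<dots> \<le> sqrt (v \<bullet> ?T v)" using ge[OF \<open>v \<in> W\<close>] by simp
  also have "\<dots> = norm (M *v v)" by (simp only: gram_inner norm_eq_sqrt_inner)
  finally show ?thesis .
qed simp

lemma norm_matrix_vector_le:
  fixes M :: "real^'m^'n"
  shows "norm (M *v v) \<le> spectral_norm M * norm v"
  unfolding spectral_norm_def by (rule onorm) (rule matrix_vector_mul_bounded_linear)

lemma spectral_norm_nonneg:
  fixes M :: "real^'m^'n"
  shows "0 \<le> spectral_norm M"
  unfolding spectral_norm_def by (rule onorm_pos_le) (rule matrix_vector_mul_bounded_linear)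

lemma norm_vector_matrix_le:
  fixes M :: "real^'m^'n"
  shows "norm (v v* M) \<le> spectral_norm M * norm v"
proof (cases "v v* M = 0")
  case False
  have "norm (v v* M) * norm (v v* M) = (v v* M) \<bullet> (v v* M)"
    by (simp add: power2_norm_eq_inner flip: power2_eq_square)
  also have "\<dots> = v \<bullet> (M *v (v v* M))" by (rule dot_lmul_matrix)
  also have "\<dots> \<le> norm v * norm (M *v (v v* M))" by (rule norm_cauchy_schwarz)
  also have "\<dots> \<le> norm v * (spectral_norm M * norm (v v* M))"
    by (intro mult_left_mono norm_matrix_vector_le norm_ge_zero)
  finally show ?thesis using False by (simp add: mult.commute)
qed (simp add: spectral_norm_nonneg)

lemma spectral_norm_le:
  fixes M :: "real^'m^'n"
  assumes "\<And>v. norm (M *v v) \<le> b * norm v"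
  shows "spectral_norm M \<le> b"
  unfolding spectral_norm_def by (rule onorm_le) (rule assms)

lemma spectral_norm_triangle:
  fixes M N :: "real^'m^'n"
  shows "spectral_norm (M + N) \<le> spectral_norm M + spectral_norm N"
proof (rule spectral_norm_le)
  fix v
  have "norm ((M + N) *v v) \<le> norm (M *v v) + norm (N *v v)"
    by (simp add: matrix_vector_mult_add_rdistrib norm_triangle_ineq)
  also have "\<dots> \<le> (spectral_norm M + spectral_norm N) * norm v"
    using norm_matrix_vector_le[of M v] norm_matrix_vector_le[of N v] by (simp add: distrib_right)
  finally show "norm ((M + N) *v v) \<le> (spectral_norm M + spectral_norm N) * norm v" .
qed

lemma spectral_norm_mult:
  fixes M :: "real^'m^'n" and N :: "real^'k^'m"
  shows "spectral_norm (M ** N) \<le> spectral_norm M * spectral_norm N"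
proof (rule spectral_norm_le)
  fix v
  have "norm ((M ** N) *v v) = norm (M *v (N *v v))" by (simp add: matrix_vector_mul_assoc)
  also have "\<dots> \<le> spectral_norm M * norm (N *v v)" by (rule norm_matrix_vector_le)
  also have "\<dots> \<le> spectral_norm M * (spectral_norm N * norm v)"
    by (intro mult_left_mono norm_matrix_vector_le spectral_norm_nonneg)
  finally show "norm ((M ** N) *v v) \<le> spectral_norm M * spectral_norm N * norm v" by simp
qed

lemma spectral_norm_minus_commute:
  fixes M N :: "real^'m^'n"
  shows "spectral_norm (M - N) = spectral_norm (N - M)"
proof -
  have "norm ((M - N) *v v) = norm ((N - M) *v v)" for v
    by (simp add: matrix_vector_mult_diff_rdistrib norm_minus_commute)
  then show ?thesis
    by (metis norm_matrix_vector_le spectral_norm_le order_antisym)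
qed

text \<open>Weyl's inequality in the case of equal ranks. The kernel of \<open>N\<close> and a singular vector for the least
positive singular value of \<open>N\<close> span a space on which \<open>N\<close> stretches by at most that value; for
dimension reasons it meets the orthogonal complement of the kernel of \<open>M\<close>, where \<open>M\<close> stretches by
at least \<open>sigma (rank M) M\<close>.\<close>

lemma sigma_rank_perturb:
  fixes M N :: "real^'m^'n"
  assumes r: "1 \<le> rank M" and rN: "rank N = rank M"
  shows "sigma (rank M) M \<le> sigma (rank N) N + spectral_norm (M - N)"
proof -
  let ?s = "sigma (rank N) N" and ?KN = "{v. N *v v = 0}" and ?KM = "{v. M *v v = 0}"
  have rN1: "1 \<le> rank N" using r rN by simp
  obtain e where e: "e \<noteq> 0" "(transpose N ** N) *v e = ?s\<^sup>2 *\<^sub>R e"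
    using sigma_rank_least(1)[OF rN1] by (auto simp: singular_values_def)
  have s0: "0 < ?s" by (rule sigma_rank_least(2)[OF rN1])
  have orth: "k \<bullet> e = 0" if "N *v k = 0" for k
    using gram_inner[of k N e] e s0 that by simp
  have Ne: "(norm (N *v e))\<^sup>2 = ?s\<^sup>2 * (norm e)\<^sup>2"
    using gram_inner[of e N e] e by (simp add: power2_norm_eq_inner)
  define V where "V = span (insert e ?KN)"
  have subK: "subspace ?KN" using linear_subspace_kernel[OF matrix_vector_mul_linear] by blast
  have bound: "norm (N *v u) \<le> ?s * norm u" if uV: "u \<in> V" for u
  proof -
    obtain a k where u: "u = a *\<^sub>R e + k" and k: "N *v k = 0"
    proof -
      obtain a where "u - a *\<^sub>R e \<in> span ?KN" using uV unfolding V_def span_insert by blast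
      also have "span ?KN = ?KN" using subK by (simp only: span_eq_iff)
      finally have "N *v (u - a *\<^sub>R e) = 0" by (rule CollectD)
      moreover have "u = a *\<^sub>R e + (u - a *\<^sub>R e)" by simp
      ultimately show ?thesis by (rule that[rotated])
    qed
    have Nu: "N *v u = a *\<^sub>R (N *v e)" by (simp add: u matrix_vector_right_distrib matrix_vector_mult_scaleR k)
    have "(norm (N *v u))\<^sup>2 = a\<^sup>2 * ?s\<^sup>2 * (norm e)\<^sup>2" by (simp add: Nu power_mult_distrib Ne)
    also have "\<dots> \<le> ?s\<^sup>2 * (a\<^sup>2 * (norm e)\<^sup>2 + (norm k)\<^sup>2)" by (simp add: algebra_simps)
    also have "a\<^sup>2 * (norm e)\<^sup>2 + (norm k)\<^sup>2 = (norm u)\<^sup>2"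
      using norm_add_Pythagorean[of "a *\<^sub>R e" k] orth[OF k]
      by (simp add: u orthogonal_def inner_commute power_mult_distrib)
    finally have "(norm (N *v u))\<^sup>2 \<le> (?s * norm u)\<^sup>2" by (simp add: power_mult_distrib)
    then show ?thesis by (rule power2_le_imp_le) (simp add: less_imp_le[OF s0])
  qed
  define W where "W = {a. \<forall>k \<in> ?KM. k \<bullet> a = 0}"
  have subW: "subspace W" unfolding W_def by (simp add: subspace_def inner_add_right)
  have dW: "rank M \<le> dim W"
  proof -
    have "range (\<lambda>u. u v* M) \<subseteq> W" unfolding W_def 
      by (auto simp: inner_commute[of _ "_ v* _"] dot_lmul_matrix)
    then have "dim (range (\<lambda>u. u v* M)) \<le> dim W" by (rule dim_subset)
    then show ?thesis using rank_dim_range[of "transpose M"] by (simp add: rank_transpose)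
  qed
  have dV: "dim V = dim ?KN + 1"
  proof -
    have "e \<notin> span ?KN" using orth e subK by (metis inner_eq_zero_iff mem_Collect_eq span_eq_iff)
    then show ?thesis unfolding V_def by (simp add: dim_insert)
  qed
  have "\<exists>u. u \<noteq> 0 \<and> u \<in> V \<inter> W"
  proof (rule ccontr)
    assume "\<not> ?thesis"
    then have "V \<inter> W \<subseteq> {0}" by auto
    then have "dim (V \<inter> W) = 0" by simp
    moreover have "dim {x + y |x y. x \<in> V \<and> y \<in> W} + dim (V \<inter> W) = dim V + dim W"
      by (rule dim_sums_Int) (simp_all add: V_def subW)
    moreover have "dim {x + y |x y. x \<in> V \<and> y \<in> W} \<le> CARD('m)"
      using dim_subset_UNIV[of "{x + y |x y. x \<in> V \<and> y \<in> W}"] by simp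
    ultimately show False using dV dW rank_nullity[of N] rN by linarith
  qed
  then obtain u where u: "u \<noteq> 0" "u \<in> V" "u \<in> W" by blast
  have "sigma (rank M) M * norm u \<le> norm (M *v u)"
    by (rule sigma_rank_lower_bound[OF r]) (use u(3) in \<open>auto simp: W_def inner_commute\<close>)
  also have "\<dots> \<le> norm (N *v u) + norm ((M - N) *v u)"
    by (metis add_diff_cancel_left' diff_add_cancel matrix_vector_mult_diff_rdistrib norm_triangle_ineq add.commute)
  also have "\<dots> \<le> ?s * norm u + spectral_norm (M - N) * norm u"
    by (intro add_mono bound u norm_matrix_vector_le)
  finally show ?thesis using u(1) by (simp flip: distrib_right)
qed

section \<open>The Moore-Penrose pseudo-inverse\<close>

definition penrose :: "real^'m^'n \<Rightarrow> real^'n^'m \<Rightarrow> bool" where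
  "penrose M P \<longleftrightarrow> M ** P ** M = M \<and> P ** M ** P = P \<and>
     transpose (M ** P) = M ** P \<and> transpose (P ** M) = P ** M"

lemma penrose_unique:
  assumes P: "penrose M P" and Q: "penrose M Q"
  shows "P = Q"
proof -
  note p = P[unfolded penrose_def] and q = Q[unfolded penrose_def]
  have MP: "M ** P = M ** Q"
  proof -
    have "M ** P = transpose (M ** Q ** (M ** P))"
      by (metis matrix_mul_assoc p q)
    also have "\<dots> = M ** P ** (M ** Q)"
      by (simp only: matrix_transpose_mul[of "M ** Q" "M ** P"] p q)
    also have "\<dots> = M ** Q" by (metis matrix_mul_assoc p)
    finally show ?thesis .
  qed
  have PM: "P ** M = Q ** M"
  proof -
    have "P ** M = transpose (P ** M ** (Q ** M))"
      by (metis matrix_mul_assoc p q)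
    also have "\<dots> = Q ** M ** (P ** M)"
      by (simp only: matrix_transpose_mul[of "P ** M" "Q ** M"] p q)
    also have "\<dots> = Q ** M" by (metis matrix_mul_assoc p)
    finally show ?thesis .
  qed
  have "P = P ** (M ** P)" using p by (simp only: matrix_mul_assoc)
  also have "\<dots> = P ** M ** Q" by (simp only: MP matrix_mul_assoc)
  also have "\<dots> = Q" using q by (simp only: PM)
  finally show ?thesis .
qed

lemma transpose_eq_selfI:
  fixes B :: "real^'n^'n"
  assumes "\<And>u v. (B *v u) \<bullet> v = u \<bullet> (B *v v)"
  shows "transpose B = B"
proof -
  have "transpose B *v u = B *v u" for u
  proof (rule vector_eq_ldot[THEN iffD1], rule allI)
    fix v
    show "v \<bullet> (transpose B *v u) = v \<bullet> (B *v u)"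
      by (simp only: transpose_matrix_vector) (metis assms dot_lmul_matrix inner_commute)
  qed
  then show ?thesis using matrix_eq by blast
qed

text \<open>The pseudo-inverse maps \<open>u\<close> to the least-squares solution of \<open>M *v v = u\<close> that is orthogonal to the
kernel of \<open>M\<close>. This solution is unique, which makes the map linear.\<close>

lemma penrose_exists:
  fixes M :: "real^'m^'n"
  shows "\<exists>P. penrose M P"
proof -
  define R where "R u v \<longleftrightarrow> (\<forall>k. M *v k = 0 \<longrightarrow> v \<bullet> k = 0) \<and> (\<forall>w. (M *v v - u) \<bullet> (M *v w) = 0)" for u v
  have uniq: "v = v'" if "R u v" "R u v'" for u v v'
  proof -
    have "(M *v (v - v')) \<bullet> (M *v (v - v')) = 0"
      using that unfolding R_def
      by (simp add: matrix_vector_mult_diff_distrib inner_diff_left algebra_simps)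
    then have k: "M *v (v - v') = 0" by simp
    then have "(v - v') \<bullet> (v - v') = 0" using that unfolding R_def by (simp add: inner_diff_left)
    then show ?thesis by simp
  qed
  have ex: "\<exists>v. R u v" for u
  proof -
    let ?S = "range ((*v) M)" and ?K = "{k. M *v k = 0}"
    have sS: "span ?S = ?S" by (simp add: linear_subspace_image subspace_UNIV)
    have sK: "span ?K = ?K" using linear_subspace_kernel[OF matrix_vector_mul_linear] by (simp only: span_eq_iff)
    obtain y z where y: "y \<in> span ?S" and z: "\<And>w. w \<in> span ?S \<Longrightarrow> orthogonal z w" and u: "u = y + z"
      by (rule orthogonal_subspace_decomp_exists[of ?S u]) blast
    obtain v0 where v0: "y = M *v v0" using y sS by auto
    obtain k v where k: "k \<in> span ?K" and v: "\<And>w. w \<in> span ?K \<Longrightarrow> orthogonal v w" and v0': "v0 = k + v"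
      by (rule orthogonal_subspace_decomp_exists[of ?K v0]) blast
    have "M *v k = 0" using k sK by auto
    then have "M *v v = y" by (simp add: v0 v0' matrix_vector_right_distrib)
    moreover have "z \<bullet> (M *v w) = 0" for w using z[of "M *v w"] sS by (simp add: orthogonal_def)
    ultimately have "R u v" unfolding R_def using v sK
      by (auto simp: u orthogonal_def)
    then show ?thesis ..
  qed
  define G where "G u = (SOME v. R u v)" for u
  have G: "R u (G u)" for u unfolding G_def using ex by (rule someI_ex)
  have "linear G"
  proof (rule linearI)
    fix a b show "G (a + b) = G a + G b"
    proof (rule uniq[OF G])
      show "R (a + b) (G a + G b)" using G[of a] G[of b] unfolding R_def
        by (simp add: matrix_vector_right_distrib inner_add_left inner_diff_left)
    qed
  next
    fix r b show "G (r *\<^sub>R b) = r *\<^sub>R G b"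
    proof (rule uniq[OF G])
      show "R (r *\<^sub>R b) (r *\<^sub>R G b)" using G[of b] unfolding R_def
        by (simp add: matrix_vector_mult_scaleR flip: scaleR_diff_right)
    qed
  qed
  then have mG: "matrix G *v u = G u" for u by (simp add: matrix_works)
  have G1: "(M *v G u) \<bullet> (M *v w) = u \<bullet> (M *v w)" for u w
    using G[of u] unfolding R_def by (simp add: inner_diff_left)
  have G2: "G u \<bullet> k = 0" if "M *v k = 0" for u k
    using G[of u] that unfolding R_def by blast
  have MGM: "M *v G (M *v w) = M *v w" for w
  proof -
    have "(M *v (G (M *v w) - w)) \<bullet> (M *v (G (M *v w) - w)) = 0"
      using G1[of "M *v w" "G (M *v w) - w"] by (simp add: matrix_vector_mult_diff_distrib inner_diff_left)
    then show ?thesis by (simp add: matrix_vector_mult_diff_distrib)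
  qed
  have "penrose M (matrix G)"
    unfolding penrose_def
  proof (intro conjI)
    show "M ** matrix G ** M = M"
      by (simp add: matrix_eq mG MGM flip: matrix_vector_mul_assoc)
    have "G (M *v G u) = G u" for u
      by (rule uniq[OF G]) (use G2 in \<open>simp add: R_def\<close>)
    then show "matrix G ** M ** matrix G = matrix G"
      by (simp add: matrix_eq mG flip: matrix_vector_mul_assoc)
    show "transpose (M ** matrix G) = M ** matrix G"
    proof (rule transpose_eq_selfI)
      fix u v
      show "((M ** matrix G) *v u) \<bullet> v = u \<bullet> ((M ** matrix G) *v v)"
        using G1[of u "G v"] G1[of v "G u"] by (simp add: mG inner_commute flip: matrix_vector_mul_assoc)
    qed
    show "transpose (matrix G ** M) = matrix G ** M"
    proof (rule transpose_eq_selfI)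
      fix u v
      have k: "M *v (w - G (M *v w)) = 0" for w
        by (simp add: matrix_vector_mult_diff_distrib MGM)
      show "((matrix G ** M) *v u) \<bullet> v = u \<bullet> ((matrix G ** M) *v v)"
        using G2[OF k[of v], of "M *v u"] G2[OF k[of u], of "M *v v"]
        by (simp add: mG inner_diff_right inner_commute flip: matrix_vector_mul_assoc)
    qed
  qed
  then show ?thesis ..
qed

lemma penrose_pinv: "penrose M (pinv M)"
  unfolding pinv_def penrose_def[symmetric]
  by (rule theI') (use penrose_exists penrose_unique in blast)

lemma pinv_apply:
  fixes M :: "real^'m^'n"
  shows "M *v (pinv M *v (M *v w)) = M *v w"
    and "pinv M *v (M *v (pinv M *v u)) = pinv M *v u"
    and "(M *v (pinv M *v u)) \<bullet> u' = u \<bullet> (M *v (pinv M *v u'))"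
    and "(pinv M *v (M *v w)) \<bullet> w' = w \<bullet> (pinv M *v (M *v w'))"
proof -
  note p = penrose_pinv[of M, unfolded penrose_def]
  show "M *v (pinv M *v (M *v w)) = M *v w"
    using p[THEN conjunct1, THEN arg_cong, of "\<lambda>N. N *v w"]
    by (simp flip: matrix_vector_mul_assoc)
  show "pinv M *v (M *v (pinv M *v u)) = pinv M *v u"
    using p[THEN conjunct2, THEN conjunct1, THEN arg_cong, of "\<lambda>N. N *v u"]
    by (simp flip: matrix_vector_mul_assoc)
  have "((M ** pinv M) *v u) \<bullet> u' = u \<bullet> (transpose (M ** pinv M) *v u')"
    by (simp only: transpose_matrix_vector inner_matrix_vector_adjoint)
  then show "(M *v (pinv M *v u)) \<bullet> u' = u \<bullet> (M *v (pinv M *v u'))"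
    using p by (simp add: matrix_vector_mul_assoc)
  have "((pinv M ** M) *v w) \<bullet> w' = w \<bullet> (transpose (pinv M ** M) *v w')"
    by (simp only: transpose_matrix_vector inner_matrix_vector_adjoint)
  then show "(pinv M *v (M *v w)) \<bullet> w' = w \<bullet> (pinv M *v (M *v w'))"
    using p by (simp add: matrix_vector_mul_assoc)
qed

lemma norm_pinv_le:
  fixes M :: "real^'m^'n"
  assumes r: "1 \<le> rank M"
  shows "sigma (rank M) M * norm (pinv M *v u) \<le> norm u"
proof -
  let ?w = "pinv M *v u"
  have "?w \<bullet> k = 0" if "M *v k = 0" for k
    using pinv_apply(4)[of M ?w k] that by (simp add: pinv_apply(2))
  then have "sigma (rank M) M * norm ?w \<le> norm (M *v ?w)"
    by (rule sigma_rank_lower_bound[OF r])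
  also have "\<dots> \<le> norm u"
  proof -
    have "norm (M *v ?w) * norm (M *v ?w) = (M *v ?w) \<bullet> (M *v ?w)"
      by (simp add: power2_norm_eq_inner flip: power2_eq_square)
    also have "\<dots> = u \<bullet> (M *v ?w)" by (simp add: pinv_apply)
    also have "\<dots> \<le> norm u * norm (M *v ?w)" by (rule norm_cauchy_schwarz)
    finally show ?thesis by (cases "M *v ?w = 0") auto
  qed
  finally show ?thesis .
qed

lemma spectral_norm_pinv_le:
  fixes M :: "real^'m^'n"
  assumes r: "1 \<le> rank M"
  shows "spectral_norm (pinv M) \<le> 1 / sigma (rank M) M"
proof (rule spectral_norm_le)
  fix u
  show "norm (pinv M *v u) \<le> 1 / sigma (rank M) M * norm u"
    using norm_pinv_le[OF r, of u] sigma_rank_least(2)[OF r] by (simp add: field_simps)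
qed

text \<open>If the kernel of \<open>B\<close> is contained in that of \<open>C\<close>, then \<open>C\<close> factors through \<open>B\<close> as
\<open>C = (C ** pinv B) ** B\<close>.\<close>

lemma kernel_subset_imp_bound:
  fixes B :: "real^'m^'n" and C :: "real^'m^'k"
  assumes "\<And>e. B *v e = 0 \<Longrightarrow> C *v e = 0"
  obtains K where "0 \<le> K" "\<And>e. norm (C *v e) \<le> K * norm (B *v e)"
proof 
  show "0 \<le> spectral_norm (C ** pinv B)" by (rule spectral_norm_nonneg)
  fix e
  have "B *v (e - pinv B *v (B *v e)) = 0"
    by (simp add: matrix_vector_mult_diff_distrib pinv_apply)
  then have "C *v e = (C ** pinv B) *v (B *v e)"
    using assms by (fastforce simp: matrix_vector_mult_diff_distrib simp flip: matrix_vector_mul_assoc)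
  then show "norm (C *v e) \<le> spectral_norm (C ** pinv B) * norm (B *v e)"
    by (simp add: norm_matrix_vector_le)
qed

section \<open>Lipschitz constants on compact sets and the radius rho\<close>

text \<open>The comparison with the Frobenius norm transfers the theorem that locally Lipschitz functions are
Lipschitz on compact sets to the spectral norm.\<close>

lemma norm_le_spectral_norm:
  fixes M :: "real^'m^'n"
  shows "norm M \<le> real (CARD('n) * CARD('m)) * spectral_norm M"
proof -
  have "norm M \<le> (\<Sum>i\<in>UNIV. norm (M $ i))"
    unfolding norm_vec_def[of M] by (rule L2_set_le_sum) simp
  also have "\<dots> \<le> (\<Sum>i\<in>UNIV. \<Sum>j\<in>UNIV. \<bar>M $ i $ j\<bar>)"
    by (intro sum_mono norm_le_l1_cart)
  also have "\<dots> \<le> (\<Sum>i\<in>(UNIV::'n set). \<Sum>j\<in>(UNIV::'m set). spectral_norm M)"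
    unfolding spectral_norm_def by (intro sum_mono matrix_component_le_onorm)
  also have "\<dots> = real (CARD('n) * CARD('m)) * spectral_norm M"
    by simp
  finally show ?thesis .
qed

lemma spectral_norm_le_norm:
  fixes M :: "real^'m^'n"
  shows "spectral_norm M \<le> real (CARD('n) * CARD('m)) * norm M"
  unfolding spectral_norm_def
proof (rule onorm_le_matrix_component[THEN order_trans])
  fix i j show "\<bar>M $ i $ j\<bar> \<le> norm M"
    by (metis Finite_Cartesian_Product.norm_nth_le order_trans real_norm_def)
qed simp

lemma locally_lipschitz_spectral_compact:
  fixes G :: "real^'k \<Rightarrow> real^'m^'n"
  assumes G: "locally_lipschitz spectral_norm G" and K: "compact K"
  obtains L where "0 \<le> L" "\<And>y z. y \<in> K \<Longrightarrow> z \<in> K \<Longrightarrow> spectral_norm (G y - G z) \<le> L * norm (y - z)"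
proof -
  define N where "N = real (CARD('n) * CARD('m))"
  have N: "0 \<le> N" by (simp add: N_def)
  have "local_lipschitz {0::real} K (\<lambda>_. G)"
  proof (rule local_lipschitzI)
    fix t :: real and x assume "x \<in> K"
    obtain e L where e: "e > 0" and L: "\<And>y z. y \<in> ball x e \<Longrightarrow> z \<in> ball x e \<Longrightarrow> spectral_norm (G y - G z) \<le> L * dist y z"
      using G unfolding locally_lipschitz_def by metis
    have "(N * \<bar>L\<bar>)-lipschitz_on (cball x (e/2) \<inter> K) G"
    proof (rule lipschitz_onI)
      fix y z assume "y \<in> cball x (e/2) \<inter> K" "z \<in> cball x (e/2) \<inter> K"
      then have "y \<in> ball x e" "z \<in> ball x e" using e by auto
      then have "spectral_norm (G y - G z) \<le> \<bar>L\<bar> * dist y z"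
        using L by (meson abs_ge_self mult_right_mono order_trans zero_le_dist)
      then have "N * spectral_norm (G y - G z) \<le> N * (\<bar>L\<bar> * dist y z)"
        using N by (rule mult_left_mono)
      then show "dist (G y) (G z) \<le> N * \<bar>L\<bar> * dist y z"
        using norm_le_spectral_norm[of "G y - G z", folded N_def]
        unfolding dist_norm mult.assoc by (rule order_trans[rotated])
    qed (simp add: N)
    then show "\<exists>u>0. \<exists>L. \<forall>s\<in>cball t u \<inter> {0}. L-lipschitz_on (cball x u \<inter> K) G"
      using e by (intro exI[of _ "e/2"]) auto
  qed
  then obtain L where L: "L-lipschitz_on K G"
    by (rule local_lipschitz_compact_implies_lipschitz[OF _ K, of "{0::real}" "\<lambda>_. G"]) auto
  show thesis
  proof (rule that[of "N * L"])
    show "0 \<le> N * L" using N lipschitz_on_nonneg[OF L] by simp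
    fix y z assume "y \<in> K" "z \<in> K"
    then have "N * norm (G y - G z) \<le> N * (L * norm (y - z))"
      using lipschitz_on_normD[OF L] N by (simp add: mult_left_mono)
    then show "spectral_norm (G y - G z) \<le> N * L * norm (y - z)"
      using spectral_norm_le_norm[of "G y - G z", folded N_def]
      unfolding mult.assoc by (rule order_trans[rotated])
  qed
qed

text \<open>The set of admissible radii is nonempty because the least positive singular value varies continuously
among matrices of equal rank (\<open>sigma_rank_perturb\<close>). It contains its supremum \<open>R\<close> because every
point of the open ball of radius \<open>R\<close> lies in a ball of smaller admissible radius.\<close>

lemma rho_props:
  fixes c :: "real^'n \<Rightarrow> real^'p"
  assumes Jc: "locally_lipschitz spectral_norm (tjac c)"
    and p': "1 \<le> p'" and x: "x \<in> interior X" and rank: "\<And>y. y \<in> X \<Longrightarrow> rank (tjac c y) = p'"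
  shows "0 < rho p' X c x" "rho p' X c x \<le> 1" "ball x (rho p' X c x) \<subseteq> X"
proof -
  let ?sig = "\<lambda>y. sigma p' (tjac c y)"
  let ?good = "\<lambda>r. 0 < r \<and> r \<le> 1 \<and> ball x r \<subseteq> X \<and> (INF y \<in> ball x r. ?sig y) \<ge> 1/2 * ?sig x"
  have xX: "x \<in> X" using x interior_subset by blast
  have pos: "0 < ?sig y" if "y \<in> X" for y
    using sigma_rank_least(2)[of "tjac c y"] rank[OF that] p' by simp
  have INF_iff: "(INF y \<in> ball x r. ?sig y) \<ge> 1/2 * ?sig x \<longleftrightarrow> (\<forall>y\<in>ball x r. 1/2 * ?sig x \<le> ?sig y)"
    if "0 < r" "ball x r \<subseteq> X" for r
  proof (rule le_cINF_iff)
    show "ball x r \<noteq> {}" using that by simp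
    show "bdd_below (?sig ` ball x r)"
      by (rule bdd_belowI2[of _ 0]) (use pos that(2) in \<open>blast intro: less_imp_le\<close>)
  qed
  obtain e0 where e0: "0 < e0" "ball x e0 \<subseteq> X" using x by (meson mem_interior)
  obtain e L where e: "0 < e" and L: "\<And>y z. y \<in> ball x e \<Longrightarrow> z \<in> ball x e \<Longrightarrow> spectral_norm (tjac c y - tjac c z) \<le> L * dist y z"
    using Jc unfolding locally_lipschitz_def by metis
  define r where "r = Min {e0, e, 1, ?sig x / (2 * (\<bar>L\<bar> + 1))}"
  have rpos: "0 < r" using e0 e pos[OF xX] by (simp add: r_def)
  have rle: "r \<le> e0" "r \<le> e" "r \<le> 1" "r \<le> ?sig x / (2 * (\<bar>L\<bar> + 1))" by (simp_all add: r_def)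
  have "?good r"
  proof (intro conjI)
    show sub: "ball x r \<subseteq> X" using e0 rle by (meson subset_ball order_trans)
    show "(INF y \<in> ball x r. ?sig y) \<ge> 1/2 * ?sig x"
      unfolding INF_iff[OF rpos sub]
    proof
      fix y assume y: "y \<in> ball x r"
      then have yX: "y \<in> X" using sub by auto
      have "spectral_norm (tjac c x - tjac c y) \<le> L * dist x y"
        using L[of x y] y e rle by auto
      also have "\<dots> \<le> (\<bar>L\<bar> + 1) * r" using y by (intro mult_mono) auto
      also have "\<dots> \<le> ?sig x / 2" using rle(4) by (simp add: field_simps)
      finally show "1/2 * ?sig x \<le> ?sig y"
        using sigma_rank_perturb[of "tjac c x" "tjac c y"] rank[OF xX] rank[OF yX] p' by simp
    qed
  qed (use rpos rle in auto)
  define R where "R = Sup {r. ?good r}"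
  have bdd: "bdd_above {r. ?good r}" by (intro bdd_aboveI[of _ 1]) auto
  have Rle: "s \<le> R" if "?good s" for s unfolding R_def using that bdd by (intro cSup_upper) auto
  have less: "\<exists>s. ?good s \<and> t < s" if "t < R" for t
    using less_cSup_iff[of "{r. ?good r}" t] that \<open>?good r\<close> bdd unfolding R_def by auto
  have "?good R"
  proof (intro conjI)
    show R0: "0 < R" using Rle[OF \<open>?good r\<close>] rpos by simp
    show "R \<le> 1" unfolding R_def using \<open>?good r\<close> by (intro cSup_least) auto
    have in_good: "\<exists>s. ?good s \<and> y \<in> ball x s" if "y \<in> ball x R" for y
      using less[of "dist x y"] that by auto
    show sub: "ball x R \<subseteq> X" using in_good by blast
    show "(INF y \<in> ball x R. ?sig y) \<ge> 1/2 * ?sig x"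
      unfolding INF_iff[OF R0 sub]
    proof
      fix y assume "y \<in> ball x R"
      then obtain s where "?good s" "y \<in> ball x s" using in_good by blast
      then show "1/2 * ?sig x \<le> ?sig y" using INF_iff[of s] by blast
    qed
  qed
  then have "rho p' X c x = R" unfolding rho_def using Rle by (intro Greatest_equality) auto
  with \<open>?good R\<close> show "0 < rho p' X c x" "rho p' X c x \<le> 1" "ball x (rho p' X c x) \<subseteq> X" by auto
qed

text \<open>A real supremum only bounds its elements if the set is bounded above. The next lemmas provide this for
the suprema that define the constants.\<close>

lemma bdd_above_spectral_norm:
  fixes G :: "real^'k \<Rightarrow> real^'m^'n"
  assumes "0 \<le> L" "\<And>y z. y \<in> K \<Longrightarrow> z \<in> K \<Longrightarrow> spectral_norm (G y - G z) \<le> L * norm (y - z)"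
    and "bounded K"
  shows "bdd_above ((\<lambda>y. spectral_norm (G y)) ` K)"
proof (cases "K = {}")
  case False
  then obtain a where a: "a \<in> K" by blast
  obtain B where B: "\<And>y. y \<in> K \<Longrightarrow> norm (y - a) \<le> B" "0 \<le> B"
    using \<open>bounded K\<close> a unfolding bounded_any_center[of K a] 
    by (metis dist_norm norm_minus_commute norm_ge_zero order_trans)
  show ?thesis
  proof (rule bdd_aboveI2)
    fix y assume y: "y \<in> K"
    have "spectral_norm (G y) \<le> spectral_norm (G y - G a) + spectral_norm (G a)"
      using spectral_norm_triangle[of "G y - G a" "G a"] by simp
    also have "\<dots> \<le> L * B + spectral_norm (G a)"
      using assms(2)[OF y a] mult_left_mono[OF B(1)[OF y] \<open>0 \<le> L\<close>] by simp
    finally show "spectral_norm (G y) \<le> L * B + spectral_norm (G a)" .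
  qed
qed simp

lemma sup_norm_on_ge:
  assumes "bdd_above ((\<lambda>y. spectral_norm (G y)) ` S)" "y \<in> S"
  shows "spectral_norm (G y) \<le> sup_norm_on S G"
  unfolding sup_norm_on_def by (rule cSUP_upper[OF assms(2,1)])

lemma lip_const_ge:
  fixes G :: "real^'k \<Rightarrow> real^'m^'n"
  assumes L: "\<And>y z. y \<in> S \<Longrightarrow> z \<in> S \<Longrightarrow> spectral_norm (G y - G z) \<le> L * norm (y - z)"
    and y: "y \<in> S" and z: "z \<in> S"
  shows "spectral_norm (G y - G z) \<le> lip_const S G * norm (y - z)"
proof (cases "y = z")
  case True
  then show ?thesis 
    using spectral_norm_le[of "0 :: real^'m^'n" 0] by simp
next
  case False
  let ?Q = "{(y, z). y \<in> S \<and> z \<in> S \<and> y \<noteq> z}"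
  have "bdd_above ((\<lambda>(y, z). spectral_norm (G y - G z) / norm (y - z)) ` ?Q)"
    by (rule bdd_aboveI2[of _ _ L]) (auto simp: divide_le_eq L)
  moreover have "(y, z) \<in> ?Q" using y z False by simp
  ultimately have "(case (y, z) of (y, z) \<Rightarrow> spectral_norm (G y - G z) / norm (y - z)) \<le> lip_const S G"
    unfolding lip_const_def by (intro cSUP_upper)
  then show ?thesis using False by (simp add: divide_le_eq)
qed

lemma lip_const_nonneg:
  fixes G :: "real^'k \<Rightarrow> real^'m^'n"
  assumes L: "\<And>y z. y \<in> S \<Longrightarrow> z \<in> S \<Longrightarrow> spectral_norm (G y - G z) \<le> L * norm (y - z)"
    and "y \<in> S" "z \<in> S" "y \<noteq> z"
  shows "0 \<le> lip_const S G"
proof -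
  have "0 \<le> lip_const S G * norm (y - z)"
    using lip_const_ge[of S G L y z] assms spectral_norm_nonneg[of "G y - G z"] by (simp add: order_trans)
  then show ?thesis using \<open>y \<noteq> z\<close> by (simp add: zero_le_mult_iff)
qed

section \<open>An error bound from constant rank\<close>

lemma tjac_has_derivative:
  fixes c :: "real^'n \<Rightarrow> real^'p"
  assumes "c differentiable (at z)"
  shows "(c has_derivative (\<lambda>h. h v* tjac c z)) (at z)"
  using assms unfolding jacobian_works by (simp add: tjac_def)

lemma bounded_linear_vector_matrix_mult: "bounded_linear (\<lambda>h. h v* (M :: real^'m^'n))"
proof -
  have "(\<lambda>h. h v* M) = (*v) (transpose M)" by (simp add: fun_eq_iff)
  then show ?thesis by simp
qed

lemma dim_kernel_vector_matrix:
  fixes M :: "real^'m^'n"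
  shows "dim {h. h v* M = 0} + rank M = CARD('n)"
  using rank_nullity[of "transpose M"] by (simp add: rank_transpose)

text \<open>Let \<open>P = pinv (tjac c x)\<close>, so that \<open>Q h = h v* tjac c x v* P\<close> is the orthogonal projection onto the
complement of the kernel of \<open>D c x\<close>, and let \<open>g z = z - \<Phi> z\<close> for the map
\<open>\<Phi> z = (z - x) - Q (z - x) + c z v* P\<close>. The assumption on the Jacobians makes \<open>g\<close> a
\<open>\<kappa>\<close>-contraction. Hence \<open>\<Phi> z = s w\<close>, with \<open>w\<close> the kernel component of \<open>y - x\<close>, has a solution
\<open>Z s\<close> for each \<open>s\<close> between 0 and 1, by Banach's fixed point theorem. On this curve
\<open>c (Z s) v* P = 0\<close>, and since \<open>D c\<close> has constant rank, its kernel is the one of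
\<open>h \<mapsto> D c h v* P\<close>; thus \<open>c\<close> has zero derivative along the curve and \<open>Z 1\<close> is feasible because
\<open>Z 0 = x\<close> is. Finally \<open>\<Phi> y - \<Phi> (Z 1) = c y v* P\<close>, and \<open>\<Phi>\<close> expands distances by at least
\<open>1 - \<kappa>\<close>.\<close>

lemma nearby_zero:
  fixes c :: "real^'n \<Rightarrow> real^'p" and x y :: "real^'n" and R \<kappa> :: real
  defines "\<sigma> \<equiv> sigma (rank (tjac c x)) (tjac c x)"
  assumes diff: "\<And>z. c differentiable (at z)" and cx: "c x = 0"
    and r: "1 \<le> rank (tjac c x)"
    and rank: "\<And>z. z \<in> cball x R \<Longrightarrow> rank (tjac c z) = rank (tjac c x)"
    and kappa: "0 \<le> \<kappa>" "\<kappa> < 1"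
    and near: "\<And>z. z \<in> cball x R \<Longrightarrow> spectral_norm (tjac c z - tjac c x) \<le> \<kappa> * \<sigma>"
    and y: "norm (y - x) \<le> (1 - \<kappa>) * R"
  shows "\<exists>z. c z = 0 \<and> norm (z - x) \<le> R \<and> \<sigma> * (1 - \<kappa>) * norm (y - z) \<le> norm (c y)"
proof -
  define P where "P = pinv (tjac c x)"
  define Q where "Q h = h v* tjac c x v* P" for h
  have s0: "0 < \<sigma>" unfolding \<sigma>_def by (rule sigma_rank_least(2)[OF r])
  have R0: "0 \<le> R" using y kappa(2) norm_ge_zero[of "y - x"] by (smt (verit) zero_le_mult_iff)
  note pen = penrose_pinv[of "tjac c x", folded P_def, unfolded penrose_def]
  have P_norm: "norm (u v* P) \<le> norm u / \<sigma>" for u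
  proof -
    have "norm (u v* P) \<le> spectral_norm P * norm u" by (rule norm_vector_matrix_le)
    also have "\<dots> \<le> 1 / \<sigma> * norm u"
      unfolding P_def \<sigma>_def by (intro mult_right_mono spectral_norm_pinv_le r norm_ge_zero)
    finally show ?thesis by simp
  qed
  have blP: "bounded_linear (\<lambda>u. u v* P)" by (rule bounded_linear_vector_matrix_mult)
  have Q_alt: "Q h = h v* (tjac c x ** P)" for h by (simp add: Q_def vector_matrix_mul_assoc)
  have blQ: "bounded_linear Q" unfolding Q_alt by (rule bounded_linear_vector_matrix_mult)
  have QP: "Q (u v* P) = u v* P" for u
    using pen by (simp add: Q_def vector_matrix_mul_assoc matrix_mul_assoc)
  have QJ: "Q h v* tjac c x = h v* tjac c x" for h
    using pen by (simp add: Q_def vector_matrix_mul_assoc matrix_mul_assoc)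
  have QQ: "Q (Q h) = Q h" for h by (simp add: Q_def QP[unfolded Q_def])
  have Qsym: "Q h \<bullet> k = h \<bullet> Q k" for h k
  proof -
    have "Q h \<bullet> k = h \<bullet> ((tjac c x ** P) *v k)" by (simp add: Q_alt dot_lmul_matrix)
    also have "(tjac c x ** P) *v k = Q k"
      using pen unfolding Q_alt by (metis transpose_matrix_vector)
    finally show ?thesis .
  qed
  interpret Q: bounded_linear Q by (rule blQ)
  interpret P: bounded_linear "\<lambda>u. u v* P" by (rule blP)
  have proj: "norm (h - Q h) \<le> norm h" for h
  proof -
    have "norm (h - Q h) * norm (h - Q h) = (h - Q h) \<bullet> (h - Q h)"
      by (simp add: power2_norm_eq_inner flip: power2_eq_square)
    also have "\<dots> = (h - Q h) \<bullet> h"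
      using Qsym[of "h - Q h" h] by (simp add: inner_diff_right Q.diff QQ)
    also have "\<dots> \<le> norm (h - Q h) * norm h" by (rule norm_cauchy_schwarz)
    finally show ?thesis by (cases "h - Q h = 0") auto
  qed
  define g where "g z = x + Q (z - x) - c z v* P" for z
  define g' where "g' z h = Q h - h v* tjac c z v* P" for z h
  have g_deriv: "(g has_derivative g' z) (at z)" for z
  proof -
    have "(c has_derivative (\<lambda>h. h v* tjac c z)) (at z)" by (rule tjac_has_derivative[OF diff])
    from P.has_derivative[OF this] show ?thesis unfolding g_def g'_def
      by (auto intro!: derivative_eq_intros Q.has_derivative)
  qed
  have g'_norm: "norm (g' z h) \<le> \<kappa> * norm h" if "z \<in> cball x R" for z h
  proof -
    have "g' z h = (h v* (tjac c x - tjac c z)) v* P"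
      unfolding g'_def Q_def by (simp add: vector_matrix_mult_diff_rdistrib P.diff)
    then have "norm (g' z h) \<le> norm (h v* (tjac c x - tjac c z)) / \<sigma>" by (simp add: P_norm)
    also have "norm (h v* (tjac c x - tjac c z)) \<le> spectral_norm (tjac c x - tjac c z) * norm h"
      by (rule norm_vector_matrix_le)
    also have "\<dots> \<le> \<kappa> * \<sigma> * norm h"
      using near[OF that] by (intro mult_right_mono) (simp_all add: spectral_norm_minus_commute)
    finally show ?thesis using s0 by (simp add: divide_right_mono)
  qed
  have g_lip: "norm (g u - g v) \<le> \<kappa> * norm (u - v)" if "u \<in> cball x R" "v \<in> cball x R" for u v
  proof (rule differentiable_bound[OF convex_cball, where f' = g'])
    show "(g has_derivative g' z) (at z within cball x R)" for z
      using g_deriv has_derivative_at_withinI by blast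
    show "onorm (g' z) \<le> \<kappa>" if "z \<in> cball x R" for z
      by (rule onorm_le) (rule g'_norm[OF that])
  qed (use that in auto)
  have gx: "g x = x" by (simp add: g_def cx Q.zero)
  have xR: "x \<in> cball x R" using R0 by simp
  define w where "w = (y - x) - Q (y - x)"
  have Qw: "Q w = 0" by (simp add: w_def Q.diff QQ)
  have w_norm: "norm w \<le> (1 - \<kappa>) * R" unfolding w_def using proj y by (rule order_trans)
  have "\<exists>z \<in> cball x R. g z + s *\<^sub>R w = z" if s: "s \<in> {0..1}" for s
  proof -
    have "\<exists>!z\<in>cball x R. g z + s *\<^sub>R w = z"
    proof (rule Banach_fix)
      show "complete (cball x R)" by (simp add: complete_eq_closed)
      show "cball x R \<noteq> {}" using xR by blast
      show "(\<lambda>z. g z + s *\<^sub>R w) ` cball x R \<subseteq> cball x R"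
      proof (intro image_subsetI)
        fix z assume z: "z \<in> cball x R"
        have "norm (g z + s *\<^sub>R w - x) \<le> norm (g z - g x) + \<bar>s\<bar> * norm w"
          using norm_triangle_ineq[of "g z - g x" "s *\<^sub>R w"] by (simp add: gx algebra_simps)
        also have "\<dots> \<le> \<kappa> * R + 1 * ((1 - \<kappa>) * R)"
        proof (intro add_mono mult_mono w_norm)
          have "norm (g z - g x) \<le> \<kappa> * norm (z - x)" by (rule g_lip[OF z xR])
          also have "\<dots> \<le> \<kappa> * R" using z kappa by (intro mult_left_mono) (simp_all add: dist_norm norm_minus_commute)
          finally show "norm (g z - g x) \<le> \<kappa> * R" .
        qed (use s in auto)
        finally show "g z + s *\<^sub>R w \<in> cball x R" by (simp add: dist_norm norm_minus_commute algebra_simps)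
      qed
      show "dist (g u + s *\<^sub>R w) (g v + s *\<^sub>R w) \<le> \<kappa> * dist u v" if "u \<in> cball x R" "v \<in> cball x R" for u v
        using g_lip[OF that] by (simp add: dist_norm)
    qed (use kappa in auto)
    then show ?thesis by blast
  qed
  then obtain Z where Z: "\<And>s. s \<in> {0..1} \<Longrightarrow> Z s \<in> cball x R" "\<And>s. s \<in> {0..1} \<Longrightarrow> g (Z s) + s *\<^sub>R w = Z s"
    by metis
  define \<Lambda> where "\<Lambda> = norm w / (1 - \<kappa>)"
  have Z_lip: "norm (Z t - Z s) \<le> \<Lambda> * \<bar>t - s\<bar>" if "s \<in> {0..1}" "t \<in> {0..1}" for s t
  proof -
    have "Z t - Z s = (g (Z t) - g (Z s)) + (t - s) *\<^sub>R w"
      using Z(2)[OF that(1)] Z(2)[OF that(2)] by (simp add: algebra_simps)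
    then have "norm (Z t - Z s) \<le> norm (g (Z t) - g (Z s)) + \<bar>t - s\<bar> * norm w"
      by (metis norm_scaleR norm_triangle_ineq)
    also have "norm (g (Z t) - g (Z s)) \<le> \<kappa> * norm (Z t - Z s)" by (rule g_lip) (use Z that in auto)
    finally show ?thesis using kappa by (simp add: \<Lambda>_def field_simps)
  qed
  have Scz: "c (Z s) v* P = 0" if "s \<in> {0..1}" for s
  proof -
    have "x + Q (Z s - x) - c (Z s) v* P + s *\<^sub>R w = Z s" using Z(2)[OF that] by (simp add: g_def)
    then have "c (Z s) v* P = Q (Z s - x) - (Z s - x) + s *\<^sub>R w" by (simp add: algebra_simps)
    then have "Q (c (Z s) v* P) = 0" by (simp add: Q.add Q.diff Q.scaleR QQ Qw)
    then show ?thesis by (simp only: QP)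
  qed
  \<comment> \<open>The map \<open>h - Q h\<close> is injective on the larger kernel and sends it into the kernel of \<open>D c x\<close>, whose dimension is that of the smaller one.\<close>
  have ker: "h v* tjac c z = 0" if z: "z \<in> cball x R" and h: "h v* tjac c z v* P = 0" for z h
  proof -
    let ?N1 = "{h. h v* tjac c z v* P = 0}" and ?N2 = "{h. h v* tjac c z = 0}"
      and ?N3 = "{h. h v* tjac c x = 0}" and ?f = "\<lambda>h. h - Q h"
    have lin1: "linear (\<lambda>h. h v* tjac c z v* P)" and lin2: "linear (\<lambda>h. h v* tjac c z)"
      using bounded_linear_vector_matrix_mult[of "tjac c z ** P"] bounded_linear_vector_matrix_mult[of "tjac c z"]
      by (simp_all add: vector_matrix_mul_assoc bounded_linear.linear)
    have sub1: "subspace ?N1" and sub2: "subspace ?N2"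
      using linear_subspace_kernel[OF lin1] linear_subspace_kernel[OF lin2] by auto
    have linf: "linear ?f" by (intro bounded_linear.linear bounded_linear_sub bounded_linear_ident blQ)
    have inj: "inj_on ?f (span ?N1)"
    proof (rule inj_onI)
      fix a b assume "a \<in> span ?N1" "b \<in> span ?N1" and eq: "?f a = ?f b"
      moreover have "span ?N1 = ?N1" using sub1 by (simp only: span_eq_iff)
      ultimately have "a \<in> ?N1" "b \<in> ?N1" by blast+
      then have "a - b \<in> ?N1" by (rule subspace_diff[OF sub1])
      then have "g' z (a - b) = Q (a - b)" by (simp add: g'_def)
      also have "\<dots> = a - b" using eq by (simp add: Q.diff algebra_simps)
      finally have "norm (a - b) \<le> \<kappa> * norm (a - b)" using g'_norm[OF z, of "a - b"] by simp
      then show "a = b" using kappa by (smt (verit) mult_le_cancel_right1 norm_eq_zero norm_ge_zero right_minus_eq)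
    qed
    have "?f ` ?N1 \<subseteq> ?N3" by (auto simp: vector_matrix_mult_diff_distrib QJ)
    then have "dim (?f ` ?N1) \<le> dim ?N3" by (rule dim_subset)
    moreover have "dim (?f ` ?N1) = dim ?N1" by (rule dim_image_eq[OF linf inj])
    moreover have "dim ?N3 = dim ?N2"
      using dim_kernel_vector_matrix[of "tjac c x"] dim_kernel_vector_matrix[of "tjac c z"] rank[OF z] by simp
    ultimately have "?N2 = ?N1"
      by (intro subspace_dim_equal[OF sub2 sub1]) auto
    then show ?thesis using h by blast
  qed
  have "\<exists>a. \<forall>s\<in>{0..1}. c (Z s) = a"
  proof (rule has_derivative_zero_constant)
    fix s :: real assume s: "s \<in> {0..1}"
    define z where "z = Z s"
    have zR: "z \<in> cball x R" using Z s by (simp add: z_def)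
    obtain K where K: "0 \<le> K" "\<And>h. norm (h v* tjac c z) \<le> K * norm (h v* tjac c z v* P)"
      using kernel_subset_imp_bound[of "transpose (tjac c z ** P)" "transpose (tjac c z)"] ker[OF zR]
      by (auto simp: vector_matrix_mul_assoc)
    have "(c has_derivative (\<lambda>h. h v* tjac c z)) (at z)" by (rule tjac_has_derivative[OF diff])
    then have dc: "\<And>e. e > 0 \<Longrightarrow> \<exists>d>0. \<forall>z'. norm (z' - z) < d \<longrightarrow> norm (c z' - c z - (z' - z) v* tjac c z) \<le> e * norm (z' - z)"
      unfolding has_derivative_at_alt by blast
    have "\<Lambda> \<ge> 0" using kappa by (simp add: \<Lambda>_def)
    show "((\<lambda>s. c (Z s)) has_derivative (\<lambda>h. 0)) (at s within {0..1})"
      unfolding has_derivative_within_alt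
    proof (intro conjI allI impI)
      fix e :: real assume e: "e > 0"
      define C where "C = (K / \<sigma> + 1) * (\<Lambda> + 1)"
      have C: "C > 0" using K(1) s0 \<open>\<Lambda> \<ge> 0\<close> by (simp add: C_def add_nonneg_pos)
      obtain d where d: "d > 0" "\<And>z'. norm (z' - z) < d \<Longrightarrow> norm (c z' - c z - (z' - z) v* tjac c z) \<le> (e / C) * norm (z' - z)"
        using dc[of "e / C"] e C by auto
      show "\<exists>d>0. \<forall>t\<in>{0..1}. norm (t - s) < d \<longrightarrow> norm (c (Z t) - c (Z s) - 0) \<le> e * norm (t - s)"
      proof (intro exI conjI ballI impI)
        show "0 < d / (\<Lambda> + 1)" using d \<open>\<Lambda> \<ge> 0\<close> by simp
        fix t :: real assume t: "t \<in> {0..1}" "norm (t - s) < d / (\<Lambda> + 1)"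
        define E where "E = Z t - z"
        have E: "norm E \<le> (\<Lambda> + 1) * norm (t - s)"
          using Z_lip[OF s t(1)] by (simp add: E_def z_def algebra_simps) 
        also have "\<dots> < d" using t(2) \<open>\<Lambda> \<ge> 0\<close> by (simp add: field_simps)
        finally have rem: "norm (c (Z t) - c z - E v* tjac c z) \<le> (e / C) * norm E"
          using d(2) by (simp add: E_def)
        \<comment> \<open>Both \<open>c (Z t) v* P\<close> and \<open>c (Z s) v* P\<close> vanish, so only the remainder of the linearization survives.\<close>
        have "E v* tjac c z v* P = - ((c (Z t) - c z - E v* tjac c z) v* P)"
          using Scz[OF s] Scz[OF t(1)] by (simp add: P.diff z_def)
        then have "norm (E v* tjac c z v* P) \<le> norm (c (Z t) - c z - E v* tjac c z) / \<sigma>"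
          by (simp add: P_norm)
        then have "norm (E v* tjac c z) \<le> K * (norm (c (Z t) - c z - E v* tjac c z) / \<sigma>)"
          using K(2)[of E] mult_left_mono[OF _ K(1)] by (meson order_trans)
        then have "norm (c (Z t) - c z) \<le> (K / \<sigma> + 1) * norm (c (Z t) - c z - E v* tjac c z)"
          using norm_triangle_ineq[of "c (Z t) - c z - E v* tjac c z" "E v* tjac c z"]
          by (simp add: algebra_simps)
        also have "\<dots> \<le> (K / \<sigma> + 1) * ((e / C) * ((\<Lambda> + 1) * norm (t - s)))"
        proof (rule mult_left_mono)
          show "norm (c (Z t) - c z - E v* tjac c z) \<le> e / C * ((\<Lambda> + 1) * norm (t - s))"
            using rem mult_left_mono[OF E, of "e / C"] e C by simp
          show "0 \<le> K / \<sigma> + 1" using K(1) s0 by simp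
        qed
        also have "\<dots> = (e / C) * C * norm (t - s)" unfolding C_def by (simp only: mult_ac)
        also have "\<dots> = e * norm (t - s)" using C by simp
        finally show "norm (c (Z t) - c (Z s) - 0) \<le> e * norm (t - s)" by (simp add: z_def)
      qed
    qed simp
  qed simp
  then have "c (Z 1) = c (Z 0)" by auto
  \<comment> \<open>Both points are fixed points of the contraction \<open>g\<close>.\<close>
  also have "Z 0 = x"
  proof -
    have "norm (Z 0 - x) \<le> \<kappa> * norm (Z 0 - x)"
      using g_lip[of "Z 0" x] Z[of 0] xR by (simp add: gx)
    then show ?thesis using kappa by (smt (verit) mult_le_cancel_right1 norm_eq_zero norm_ge_zero right_minus_eq)
  qed
  finally have c1: "c (Z 1) = 0" by (simp add: cx)
  have "(1 - \<kappa>) * R \<le> 1 * R" using kappa R0 by (intro mult_right_mono) auto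
  then have yR: "y \<in> cball x R" using y by (simp add: dist_norm norm_minus_commute)
  have "y - Z 1 = y - (g (Z 1) + w)" using Z(2)[of 1] by simp
  also have "\<dots> = (g y - g (Z 1)) + c y v* P" by (simp add: w_def g_def[of y])
  finally have "norm (y - Z 1) \<le> norm (g y - g (Z 1)) + norm (c y v* P)"
    by (metis norm_triangle_ineq)
  also have "\<dots> \<le> \<kappa> * norm (y - Z 1) + norm (c y) / \<sigma>"
    by (intro add_mono g_lip yR P_norm Z(1)) simp
  finally have "(1 - \<kappa>) * norm (y - Z 1) \<le> norm (c y) / \<sigma>" by (simp add: algebra_simps)
  then have "\<sigma> * (1 - \<kappa>) * norm (y - Z 1) \<le> norm (c y)"
    using s0 by (simp add: pos_le_divide_eq mult_ac)
  moreover have "norm (Z 1 - x) \<le> R" using Z(1)[of 1] by (simp add: dist_norm norm_minus_commute)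
  ultimately show ?thesis using c1 by blast
qed

section \<open>Constraints of constant rank and the dissolving map\<close>

lemma matrix_mult_diff_distrib:
  fixes M :: "real^'m^'n" and N N' :: "real^'k^'m"
  shows "M ** (N - N') = M ** N - M ** N'"
  by (simp add: matrix_eq matrix_vector_mult_diff_distrib matrix_vector_mult_diff_rdistrib
      flip: matrix_vector_mul_assoc)

lemma matrix_mult_diff_rdistrib:
  fixes M M' :: "real^'m^'n" and N :: "real^'k^'m"
  shows "(M - M') ** N = M ** N - M' ** N"
  by (simp add: matrix_eq matrix_vector_mult_diff_rdistrib flip: matrix_vector_mul_assoc)

lemma spectral_norm_add_mult:
  fixes M M' :: "real^'m^'n" and N N' :: "real^'k^'m"
  shows "spectral_norm (M ** N + M' ** N')
    \<le> spectral_norm M * spectral_norm N + spectral_norm M' * spectral_norm N'"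
  by (rule order_trans[OF spectral_norm_triangle add_mono[OF spectral_norm_mult spectral_norm_mult]])

locale constant_rank_constraint =
  fixes c :: "real^'n \<Rightarrow> real^'p" and X :: "(real^'n) set" and p' :: nat
  assumes c_diff: "c differentiable (at y)"
    and Jc_lip: "locally_lipschitz spectral_norm (tjac c)"
    and p'_pos: "1 \<le> p'"
    and X_nhd: "{y. c y = 0} \<subseteq> interior X"
    and rank_Jc: "y \<in> X \<Longrightarrow> rank (tjac c y) = p'"
begin

lemma feasible_in_interior: "c x = 0 \<Longrightarrow> x \<in> interior X"
  using X_nhd by auto

lemma feasible_in_X: "c x = 0 \<Longrightarrow> x \<in> X"
  using feasible_in_interior interior_subset by blast

lemma sigma_pos: "c x = 0 \<Longrightarrow> 0 < sigma p' (tjac c x)"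
  using sigma_rank_least(2)[of "tjac c x"] rank_Jc[OF feasible_in_X] p'_pos by simp

text \<open>By \<open>nearby_zero\<close> with contraction factor 1/2 on a ball so small that the Lipschitz bound keeps the
Jacobian within half of the least positive singular value.\<close>

lemma local_error_bound:
  assumes cx: "c x = 0"
  obtains r C where "0 < r" "0 \<le> C"
    "\<And>y. y \<in> ball x r \<Longrightarrow> \<exists>z. c z = 0 \<and> norm (y - z) \<le> C * norm (c y)"
proof -
  let ?\<sigma> = "sigma p' (tjac c x)"
  have rx: "rank (tjac c x) = p'" by (rule rank_Jc[OF feasible_in_X[OF cx]])
  have s0: "0 < ?\<sigma>" by (rule sigma_pos[OF cx])
  obtain e0 where e0: "0 < e0" "ball x e0 \<subseteq> X"
    using feasible_in_interior[OF cx] by (meson mem_interior)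
  obtain e L where e: "0 < e"
    and L: "\<And>y z. y \<in> ball x e \<Longrightarrow> z \<in> ball x e \<Longrightarrow> spectral_norm (tjac c y - tjac c z) \<le> L * dist y z"
    using Jc_lip unfolding locally_lipschitz_def by metis
  define R where "R = Min {e0 / 2, e / 2, ?\<sigma> / (2 * (\<bar>L\<bar> + 1))}"
  have R0: "0 < R" using e0 e s0 by (simp add: R_def)
  have Rle: "R \<le> e0 / 2" "R \<le> e / 2" "R \<le> ?\<sigma> / (2 * (\<bar>L\<bar> + 1))"
    unfolding R_def by (rule Min_le; simp)+
  have sub: "cball x R \<subseteq> ball x e0" "cball x R \<subseteq> ball x e" using Rle e0 e by auto
  show thesis
  proof (rule that[of "R / 2" "2 / ?\<sigma>"])
    fix y assume y: "y \<in> ball x (R / 2)"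
    have "\<exists>z. c z = 0 \<and> norm (z - x) \<le> R \<and> sigma (rank (tjac c x)) (tjac c x) * (1 - 1/2) * norm (y - z) \<le> norm (c y)"
    proof (rule nearby_zero)
    show "1 \<le> rank (tjac c x)" by (simp only: rx p'_pos)
      fix z assume z: "z \<in> cball x R"
      then have "z \<in> X" using sub e0 by blast
      then show "rank (tjac c z) = rank (tjac c x)" by (simp add: rank_Jc rx)
      have "spectral_norm (tjac c z - tjac c x) \<le> L * dist z x"
        using sub z e by (intro L) auto
      also have "\<dots> \<le> (\<bar>L\<bar> + 1) * R" using z by (intro mult_mono) (auto simp: dist_commute)
      also have "\<dots> \<le> 1/2 * ?\<sigma>" using Rle(3) by (simp add: field_simps)
      finally show "spectral_norm (tjac c z - tjac c x) \<le> 1/2 * sigma (rank (tjac c x)) (tjac c x)"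
        by (simp add: rx)
    qed (use y in \<open>auto simp: c_diff cx dist_norm norm_minus_commute\<close>)
    then show "\<exists>z. c z = 0 \<and> norm (y - z) \<le> 2 / ?\<sigma> * norm (c y)"
      using s0 by (auto simp: rx field_simps)
  qed (use R0 s0 in auto)
qed

text \<open>By the error bound, each point \<open>y + t d\<close> has a feasible point within \<open>C \<parallel>c (y + t d)\<parallel> = o(t)\<close>.
These feasible points form a curve through \<open>y\<close> with velocity \<open>d\<close>, along which \<open>\<phi>\<close> is
constantly zero.\<close>

lemma tangent_derivative_zero:
  fixes \<phi> :: "real^'n \<Rightarrow> 'b::real_normed_vector"
  assumes cy: "c y = 0" and phi: "(\<phi> has_derivative \<phi>') (at y)"
    and zero: "\<And>z. c z = 0 \<Longrightarrow> \<phi> z = 0" and d: "d v* tjac c y = 0"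
  shows "\<phi>' d = 0"
proof -
  obtain r C where r: "0 < r" "0 \<le> C"
    and ex: "\<And>u. u \<in> ball y r \<Longrightarrow> \<exists>z. c z = 0 \<and> norm (u - z) \<le> C * norm (c u)"
    using local_error_bound[OF cy] by blast
  define z where "z t = (SOME z. c z = 0 \<and> norm (y + t *\<^sub>R d - z) \<le> C * norm (c (y + t *\<^sub>R d)))" for t
  define r' where "r' = r / (norm d + 1)"
  have r': "0 < r'" using r by (simp add: r'_def add_nonneg_pos)
  have z: "c (z t) = 0 \<and> norm (y + t *\<^sub>R d - z t) \<le> C * norm (c (y + t *\<^sub>R d))" if "\<bar>t\<bar> < r'" for t
  proof -
    have "\<bar>t\<bar> * norm d \<le> \<bar>t\<bar> * (norm d + 1)" by (intro mult_left_mono) auto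
    also have "\<dots> < r" using that by (simp add: r'_def field_simps add_pos_nonneg)
    finally have "y + t *\<^sub>R d \<in> ball y r" by (simp add: dist_norm)
    from ex[OF this] show ?thesis unfolding z_def by (rule someI_ex)
  qed
  have z0: "z 0 = y" using z[of 0] r' cy by simp
  have "((\<lambda>t. c (y + t *\<^sub>R d)) has_derivative (\<lambda>t. (t *\<^sub>R d) v* tjac c y)) (at 0)"
    by (rule has_derivative_compose[where g = c and f = "\<lambda>t. y + t *\<^sub>R d"])
       (auto intro!: derivative_eq_intros tjac_has_derivative c_diff)
  then have dc: "\<And>e. e > 0 \<Longrightarrow> \<exists>\<delta>>0. \<forall>t. norm (t - 0) < \<delta> \<longrightarrow>
      norm (c (y + t *\<^sub>R d) - c (y + 0 *\<^sub>R d) - ((t - 0) *\<^sub>R d) v* tjac c y) \<le> e * norm (t - 0)"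
    unfolding has_derivative_at_alt by blast
  have "(z has_derivative (\<lambda>t. t *\<^sub>R d)) (at 0)"
    unfolding has_derivative_at_alt
  proof (intro conjI allI impI)
    fix e :: real assume e: "e > 0"
    obtain \<delta> where \<delta>: "\<delta> > 0" and small: "\<And>t. \<bar>t\<bar> < \<delta> \<Longrightarrow> norm (c (y + t *\<^sub>R d)) \<le> e / (C + 1) * \<bar>t\<bar>"
      using dc[of "e / (C + 1)"] e r cy d by (auto simp: scaleR_vector_matrix_assoc)
    show "\<exists>\<delta>>0. \<forall>t. norm (t - 0) < \<delta> \<longrightarrow> norm (z t - z 0 - (t - 0) *\<^sub>R d) \<le> e * norm (t - 0)"
    proof (intro exI conjI allI impI)
      show "0 < min \<delta> r'" using \<delta> r' by simp
      fix t :: real assume t: "norm (t - 0) < min \<delta> r'"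
      have "norm (z t - z 0 - (t - 0) *\<^sub>R d) = norm (y + t *\<^sub>R d - z t)"
        by (simp add: z0 norm_minus_commute algebra_simps)
      also have "\<dots> \<le> C * norm (c (y + t *\<^sub>R d))" using z t by simp
      also have "\<dots> \<le> C * (e / (C + 1) * \<bar>t\<bar>)" using small t r by (intro mult_left_mono) auto
      also have "\<dots> \<le> (C + 1) * (e / (C + 1) * \<bar>t\<bar>)" using e r by (intro mult_right_mono) auto
      also have "\<dots> = e * \<bar>t\<bar>" using r by simp
      finally show "norm (z t - z 0 - (t - 0) *\<^sub>R d) \<le> e * norm (t - 0)" by simp
    qed
  qed (rule bounded_linear_scaleR_left)
  moreover have "(\<phi> has_derivative \<phi>') (at (z 0))" using phi z0 by simp
  ultimately have "((\<lambda>t. \<phi> (z t)) has_derivative (\<lambda>t. \<phi>' (t *\<^sub>R d))) (at 0)"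
    by (rule has_derivative_compose)
  then have "((\<lambda>t. 0) has_derivative (\<lambda>t. \<phi>' (t *\<^sub>R d))) (at 0)"
    by (rule has_derivative_transform_within[OF _ r']) (use z zero in \<open>auto simp: dist_norm\<close>)
  then have "(\<lambda>t::real. \<phi>' (t *\<^sub>R d)) = (\<lambda>t. 0)"
    by (rule has_derivative_unique) (rule has_derivative_const)
  from fun_cong[OF this, of 1] show ?thesis by simp
qed

end

lemma le_quot_inf_imp:
  assumes "ereal t \<le> quot_inf a b" "0 \<le> a" "0 \<le> b"
  shows "t * b \<le> a"
  using assms by (cases "b = 0") (auto simp: quot_inf_def field_simps)

lemma quot_inf_pos: "0 < a \<Longrightarrow> 0 \<le> b \<Longrightarrow> 0 < quot_inf a b"
  by (auto simp: quot_inf_def)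

locale constraint_dissolving = constant_rank_constraint c X p'
  for c :: "real^'n \<Rightarrow> real^'p" and X p' +
  fixes A :: "real^'n \<Rightarrow> real^'n"
  assumes A_diff: "A differentiable (at y)"
    and JA_lip: "locally_lipschitz spectral_norm (tjac A)"
    and A_fix: "c y = 0 \<Longrightarrow> A y = y"
    and JA_Jc: "c y = 0 \<Longrightarrow> tjac A y ** tjac c y = 0"
begin

lemma A_has_derivative: "(A has_derivative (\<lambda>h. h v* tjac A y)) (at y)"
  by (rule tjac_has_derivative[OF A_diff])

lemma c_has_derivative: "(c has_derivative (\<lambda>h. h v* tjac c y)) (at y)"
  by (rule tjac_has_derivative[OF c_diff])

lemma DA_into_tangent: "c y = 0 \<Longrightarrow> d v* tjac A y v* tjac c y = 0"
  by (simp add: vector_matrix_mul_assoc JA_Jc)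

lemma DA_tangent:
  assumes cy: "c y = 0" and d: "d v* tjac c y = 0"
  shows "d v* tjac A y = d"
proof -
  have "((\<lambda>z. A z - z) has_derivative (\<lambda>h. h v* tjac A y - h)) (at y)"
    by (intro has_derivative_diff A_has_derivative has_derivative_ident)
  then have "d v* tjac A y - d = 0"
    by (rule tangent_derivative_zero[OF cy _ _ d]) (simp add: A_fix)
  then show ?thesis by simp
qed

context
  fixes x :: "real^'n"
  assumes cx: "c x = 0"
begin

abbreviation "\<rho> \<equiv> rho p' X c x"
abbreviation "\<Theta> \<equiv> {y. norm (y - x) \<le> \<rho>}"
abbreviation "Mc \<equiv> sup_norm_on \<Theta> (tjac c)"
abbreviation "MA \<equiv> sup_norm_on \<Theta> (tjac A)"
abbreviation "Lc \<equiv> lip_const \<Theta> (tjac c)"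
abbreviation "LA \<equiv> lip_const \<Theta> (tjac A)"
abbreviation "Lb \<equiv> lip_const \<Theta> (\<lambda>y. tjac A y ** tjac c (A y))"

lemmas rho = rho_props[OF Jc_lip p'_pos feasible_in_interior[OF cx] rank_Jc]

lemma Theta_cball: "\<Theta> = cball x \<rho>"
  by (auto simp: dist_norm norm_minus_commute)

lemma compact_Theta: "compact \<Theta>"
  unfolding Theta_cball by (rule compact_cball)

lemma Theta_two_points: obtains y z where "y \<in> \<Theta>" "z \<in> \<Theta>" "y \<noteq> z"
proof 
  show "x \<in> \<Theta>" using rho(1) by simp
  show "x + \<rho> *\<^sub>R axis undefined 1 \<in> \<Theta>" using rho(1) by simp
  show "x \<noteq> x + \<rho> *\<^sub>R axis undefined 1" using rho(1) by simp
qed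

lemma Lc_nonneg: "0 \<le> Lc" and Lc: "y \<in> \<Theta> \<Longrightarrow> z \<in> \<Theta> \<Longrightarrow> spectral_norm (tjac c y - tjac c z) \<le> Lc * norm (y - z)"
  and Mc: "y \<in> \<Theta> \<Longrightarrow> spectral_norm (tjac c y) \<le> Mc"
proof -
  obtain L where L: "0 \<le> L" "\<And>y z. y \<in> \<Theta> \<Longrightarrow> z \<in> \<Theta> \<Longrightarrow> spectral_norm (tjac c y - tjac c z) \<le> L * norm (y - z)"
    using locally_lipschitz_spectral_compact[OF Jc_lip compact_Theta] by metis
  show "0 \<le> Lc" using Theta_two_points lip_const_nonneg[OF L(2)] by metis
  show "spectral_norm (tjac c y - tjac c z) \<le> Lc * norm (y - z)" if "y \<in> \<Theta>" "z \<in> \<Theta>" for y z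
    by (rule lip_const_ge[OF L(2) that])
  show "spectral_norm (tjac c y) \<le> Mc" if "y \<in> \<Theta>" for y
    by (rule sup_norm_on_ge[OF bdd_above_spectral_norm[OF L compact_imp_bounded[OF compact_Theta]] that])
qed

lemma LA_nonneg: "0 \<le> LA" and LA: "y \<in> \<Theta> \<Longrightarrow> z \<in> \<Theta> \<Longrightarrow> spectral_norm (tjac A y - tjac A z) \<le> LA * norm (y - z)"
  and MA: "y \<in> \<Theta> \<Longrightarrow> spectral_norm (tjac A y) \<le> MA"
proof -
  obtain L where L: "0 \<le> L" "\<And>y z. y \<in> \<Theta> \<Longrightarrow> z \<in> \<Theta> \<Longrightarrow> spectral_norm (tjac A y - tjac A z) \<le> L * norm (y - z)"
    using locally_lipschitz_spectral_compact[OF JA_lip compact_Theta] by metis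
  show "0 \<le> LA" using Theta_two_points lip_const_nonneg[OF L(2)] by metis
  show "spectral_norm (tjac A y - tjac A z) \<le> LA * norm (y - z)" if "y \<in> \<Theta>" "z \<in> \<Theta>" for y z
    by (rule lip_const_ge[OF L(2) that])
  show "spectral_norm (tjac A y) \<le> MA" if "y \<in> \<Theta>" for y
    by (rule sup_norm_on_ge[OF bdd_above_spectral_norm[OF L compact_imp_bounded[OF compact_Theta]] that])
qed

lemma M_nonneg: "0 \<le> Mc" "0 \<le> MA"
proof -
  obtain y where "y \<in> \<Theta>" using Theta_two_points by metis
  then show "0 \<le> Mc" "0 \<le> MA"
    using Mc MA spectral_norm_nonneg[of "tjac c y"] spectral_norm_nonneg[of "tjac A y"]
    by (meson order_trans)+
qed

text \<open>Nonnegativity is not automatic for a real supremum: the difference quotients of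
\<open>tjac A y ** tjac c (A y)\<close> must be bounded, which follows from Lipschitz bounds for \<open>A\<close> and
\<open>tjac A\<close> on \<open>\<Theta>\<close> and for \<open>tjac c\<close> on the compact image of \<open>\<Theta>\<close> under \<open>A\<close>.\<close>

lemma Lb_nonneg: "0 \<le> Lb"
proof -
  have contA: "continuous_on S A" for S
    by (meson A_diff continuous_at_imp_continuous_on differentiable_imp_continuous_within)
  have K: "compact (A ` \<Theta>)" by (rule compact_continuous_image[OF contA compact_Theta])
  obtain L where L: "0 \<le> L" "\<And>y z. y \<in> A ` \<Theta> \<Longrightarrow> z \<in> A ` \<Theta> \<Longrightarrow> spectral_norm (tjac c y - tjac c z) \<le> L * norm (y - z)"
    using locally_lipschitz_spectral_compact[OF Jc_lip K] by metis
  define M where "M = sup_norm_on (A ` \<Theta>) (tjac c)"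
  have M: "spectral_norm (tjac c y) \<le> M" if "y \<in> A ` \<Theta>" for y
    unfolding M_def by (rule sup_norm_on_ge[OF bdd_above_spectral_norm[OF L compact_imp_bounded[OF K]] that])
  have A_lip: "norm (A y - A z) \<le> MA * norm (y - z)" if "y \<in> \<Theta>" "z \<in> \<Theta>" for y z
  proof (rule differentiable_bound[where f' = "\<lambda>u h. h v* tjac A u"])
    show "convex \<Theta>" unfolding Theta_cball by (rule convex_cball)
    show "(A has_derivative (\<lambda>h. h v* tjac A u)) (at u within \<Theta>)" for u
      using A_has_derivative by (rule has_derivative_at_withinI)
    show "onorm (\<lambda>h. h v* tjac A u) \<le> MA" if "u \<in> \<Theta>" for u
      by (rule onorm_le, rule order_trans[OF norm_vector_matrix_le]) (intro mult_right_mono MA that norm_ge_zero)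
  qed (use that in auto)
  have bound: "spectral_norm (tjac A y ** tjac c (A y) - tjac A z ** tjac c (A z)) \<le> (MA * (L * MA) + LA * M) * norm (y - z)"
    if y: "y \<in> \<Theta>" and z: "z \<in> \<Theta>" for y z
  proof -
    have "tjac A y ** tjac c (A y) - tjac A z ** tjac c (A z)
        = tjac A y ** (tjac c (A y) - tjac c (A z)) + (tjac A y - tjac A z) ** tjac c (A z)"
      by (simp add: matrix_mult_diff_distrib matrix_mult_diff_rdistrib)
    then have "spectral_norm (tjac A y ** tjac c (A y) - tjac A z ** tjac c (A z))
        \<le> spectral_norm (tjac A y) * spectral_norm (tjac c (A y) - tjac c (A z))
          + spectral_norm (tjac A y - tjac A z) * spectral_norm (tjac c (A z))"
      by (simp only: spectral_norm_add_mult)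
    also have "\<dots> \<le> MA * (L * (MA * norm (y - z))) + (LA * norm (y - z)) * M"
    proof (intro add_mono mult_mono)
      have "spectral_norm (tjac c (A y) - tjac c (A z)) \<le> L * norm (A y - A z)" using y z by (intro L) auto
      also have "\<dots> \<le> L * (MA * norm (y - z))" by (intro mult_left_mono A_lip y z L)
      finally show "spectral_norm (tjac c (A y) - tjac c (A z)) \<le> L * (MA * norm (y - z))" .
      show "spectral_norm (tjac c (A z)) \<le> M" by (rule M) (use z in blast)
    qed (use y z in \<open>simp_all add: MA LA LA_nonneg M_nonneg spectral_norm_nonneg\<close>)
    finally show ?thesis by (simp add: algebra_simps)
  qed
  obtain y z where "y \<in> \<Theta>" "z \<in> \<Theta>" "y \<noteq> z" by (rule Theta_two_points)
  then show ?thesis using lip_const_nonneg[OF bound] by blast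
qed

text \<open>A positive radius makes \<open>Omega\<close> a ball with interior, so that a feasible point of it is approached
from within along enough directions for the second-order limits.\<close>

lemma eps_pos: "0 < eps p' X c A x"
proof -
  have b: "0 \<le> 32 * Lc * (MA + 1)" "0 \<le> 8 * (Lb + Lc) * Mc" "0 \<le> 5 * (Lb + LA * Mc)"
    using Lc_nonneg LA_nonneg Lb_nonneg M_nonneg by auto
  show ?thesis
    unfolding eps_def Let_def using rho(1) sigma_pos[OF cx] quot_inf_pos b by simp
qed

lemma Omega_cball: obtains \<epsilon> where "0 < \<epsilon>" "Omega p' X c A x = cball x \<epsilon>"
proof -
  have "eps p' X c A x \<le> ereal (\<rho> / 2)" unfolding eps_def Let_def by (rule Min_le) auto
  then obtain \<epsilon> where e: "eps p' X c A x = ereal \<epsilon>"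
    using eps_pos by (cases "eps p' X c A x") auto
  show thesis
    by (rule that[of \<epsilon>]) (use eps_pos e in \<open>auto simp: Omega_def dist_norm norm_minus_commute\<close>)
qed

text \<open>Let \<open>z\<close> be the feasible point near \<open>y\<close> from the error bound and \<open>e = \<parallel>y - z\<parallel>\<close>. Up to
errors of order \<open>e\<^sup>2\<close>, \<open>D c y (y - z)\<close> is \<open>c y\<close> by Taylor expansion, and
\<open>D c y (A y - z)\<close> vanishes because \<open>D c z \<circ> D A z = 0\<close>. Hence the inner product is
\<open>\<parallel>c y\<parallel>\<^sup>2\<close> up to an error of at most \<open>\<parallel>c y\<parallel> e\<^sup>2 B\<close>. As \<open>e\<close> is at most a
constant times \<open>\<parallel>c y\<parallel>\<close> and also at most a constant times the distance of \<open>y\<close> from \<open>x\<close>, the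
definition of the radius makes this error less than \<open>\<parallel>c y\<parallel>\<^sup>2\<close>.\<close>

lemma inner_dissolving_direction_pos:
  assumes y: "y \<in> Omega p' X c A x" and cy: "c y \<noteq> 0"
  shows "0 < (y - A y) \<bullet> (tjac c y *v c y)"
proof -
  define \<sigma> where "\<sigma> = sigma p' (tjac c x)"
  define \<eta> where "\<eta> = norm (y - x)"
  \<comment> \<open>The error bound is used with contraction factor 1/16, so the curve stays within \<open>\<eta> / (1 - 1/16)\<close>; the bound \<open>\<eta> Lc \<le> \<sigma> / 32\<close> permits this, as \<open>16/15 * 1/32 \<le> 1/16\<close>.\<close>
  define R where "R = 16 / 15 * \<eta>"
  have rx: "rank (tjac c x) = p'" by (rule rank_Jc[OF feasible_in_X[OF cx]])
  have s0: "0 < \<sigma>" unfolding \<sigma>_def by (rule sigma_pos[OF cx])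
  have e0: "0 \<le> \<eta>" by (simp add: \<eta>_def)
  note nonneg = Lc_nonneg LA_nonneg Lb_nonneg M_nonneg
  have "ereal \<eta> \<le> ereal (\<rho> / 2)" "ereal \<eta> \<le> quot_inf \<sigma> (32 * Lc * (MA + 1))"
    "ereal \<eta> \<le> quot_inf \<sigma> (5 * (Lb + LA * Mc))"
    using y unfolding Omega_def eps_def Let_def \<eta>_def \<sigma>_def by (simp_all)
  then have h1: "\<eta> \<le> \<rho> / 2" and h2: "\<eta> * (32 * Lc * (MA + 1)) \<le> \<sigma>" and h3: "\<eta> * (5 * (Lb + LA * Mc)) \<le> \<sigma>"
    using s0 nonneg by (auto intro!: le_quot_inf_imp)
  have R_lt: "R < \<rho>" using h1 rho(1) e0 by (simp add: R_def)
  have sub: "cball x R \<subseteq> ball x \<rho>" using R_lt by auto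
  have subT: "cball x R \<subseteq> \<Theta>" unfolding Theta_cball using R_lt by auto
  have h2': "\<eta> * Lc \<le> \<sigma> / 32"
  proof -
    have "\<eta> * Lc * 1 \<le> \<eta> * Lc * (MA + 1)" using e0 nonneg by (intro mult_left_mono) auto
    then show ?thesis using h2 by (simp add: algebra_simps)
  qed
  have xT: "x \<in> \<Theta>" using rho(1) by simp
  have "\<exists>z. c z = 0 \<and> norm (z - x) \<le> R \<and> sigma (rank (tjac c x)) (tjac c x) * (1 - 1/16) * norm (y - z) \<le> norm (c y)"
  proof (rule nearby_zero)
    show "1 \<le> rank (tjac c x)" by (simp only: rx p'_pos)
    fix z assume z: "z \<in> cball x R"
    then have "z \<in> X" using sub rho(3) by blast
    then show "rank (tjac c z) = rank (tjac c x)" by (simp add: rank_Jc rx)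
    have "spectral_norm (tjac c z - tjac c x) \<le> Lc * norm (z - x)"
      using subT z xT by (intro Lc) auto
    also have "\<dots> \<le> Lc * R" using z nonneg by (intro mult_left_mono) (auto simp: dist_norm norm_minus_commute)
    also have "\<dots> = 16/15 * (\<eta> * Lc)" by (simp add: R_def)
    also have "\<dots> \<le> 1/16 * \<sigma>" using h2' s0 by simp
    finally show "spectral_norm (tjac c z - tjac c x) \<le> 1/16 * sigma (rank (tjac c x)) (tjac c x)"
      by (simp add: rx \<sigma>_def)
  qed (auto simp: c_diff cx R_def \<eta>_def)
  then obtain z where z: "c z = 0" "norm (z - x) \<le> R" and ze: "\<sigma> * (15/16) * norm (y - z) \<le> norm (c y)"
    by (auto simp: rx \<sigma>_def)
  define e where "e = norm (y - z)"
  have e: "0 \<le> e" "e \<le> 31/15 * \<eta>"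
    using norm_triangle_ineq[of "y - x" "x - z"] z(2) by (simp_all add: e_def R_def \<eta>_def norm_minus_commute)
  let ?S = "closed_segment y z"
  have yT: "y \<in> \<Theta>" using h1 e0 rho(1) by (simp add: \<eta>_def)
  have zT: "z \<in> \<Theta>" using z(2) R_lt by simp
  have ST: "?S \<subseteq> \<Theta>" using yT zT unfolding Theta_cball by (simp add: closed_segment_subset)
  have Sy: "norm (u - y) \<le> e" and Sz: "norm (u - z) \<le> e" if "u \<in> ?S" for u
    using segment_bound[OF that] by (simp_all add: e_def norm_minus_commute)
  have v1: "norm (c y - c z - (y - z) v* tjac c y) \<le> Lc * e * e"
  proof -
    have "norm ((c y - y v* tjac c y) - (c z - z v* tjac c y)) \<le> Lc * e * norm (y - z)"
    proof (rule differentiable_bound[where f' = "\<lambda>u h. h v* tjac c u - h v* tjac c y"])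
      show "((\<lambda>u. c u - u v* tjac c y) has_derivative (\<lambda>h. h v* tjac c u - h v* tjac c y)) (at u within ?S)" for u
        by (intro has_derivative_diff has_derivative_at_withinI[OF c_has_derivative]
            bounded_linear_imp_has_derivative bounded_linear_vector_matrix_mult)
      fix u assume u: "u \<in> ?S"
      show "onorm (\<lambda>h. h v* tjac c u - h v* tjac c y) \<le> Lc * e"
      proof (rule onorm_le)
        fix h
        have "norm (h v* tjac c u - h v* tjac c y) \<le> spectral_norm (tjac c u - tjac c y) * norm h"
          using norm_vector_matrix_le[of h "tjac c u - tjac c y"] by (simp add: vector_matrix_mult_diff_rdistrib)
        also have "spectral_norm (tjac c u - tjac c y) \<le> Lc * norm (u - y)" using ST u yT by (intro Lc) auto
        also have "\<dots> \<le> Lc * e" using Sy[OF u] nonneg by (intro mult_left_mono)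
        finally show "norm (h v* tjac c u - h v* tjac c y) \<le> Lc * e * norm h" by (simp add: mult_right_mono)
      qed
    qed auto
    then show ?thesis by (simp add: e_def vector_matrix_mult_diff_distrib algebra_simps)
  qed
  have v2: "norm ((A y - z) v* tjac c y) \<le> (MA * Lc * e + LA * e * Mc) * e"
  proof -
    have "norm (A y v* tjac c y - A z v* tjac c y) \<le> (MA * Lc * e + LA * e * Mc) * norm (y - z)"
    proof (rule differentiable_bound[where f' = "\<lambda>u h. h v* tjac A u v* tjac c y"])
      show "((\<lambda>u. A u v* tjac c y) has_derivative (\<lambda>h. h v* tjac A u v* tjac c y)) (at u within ?S)" for u
        by (rule bounded_linear.has_derivative[OF bounded_linear_vector_matrix_mult has_derivative_at_withinI[OF A_has_derivative]])
      fix u assume u: "u \<in> ?S"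
      have "tjac A u ** tjac c y = tjac A z ** (tjac c y - tjac c z) + (tjac A u - tjac A z) ** tjac c y"
        using JA_Jc[OF z(1)] by (simp add: matrix_mult_diff_distrib matrix_mult_diff_rdistrib)
      then have "spectral_norm (tjac A u ** tjac c y) \<le> spectral_norm (tjac A z) * spectral_norm (tjac c y - tjac c z)
          + spectral_norm (tjac A u - tjac A z) * spectral_norm (tjac c y)"
        by (simp only: spectral_norm_add_mult)
      also have "\<dots> \<le> MA * (Lc * e) + (LA * e) * Mc"
      proof (intro add_mono mult_mono)
        show "spectral_norm (tjac c y - tjac c z) \<le> Lc * e" unfolding e_def by (rule Lc[OF yT zT])
        have "spectral_norm (tjac A u - tjac A z) \<le> LA * norm (u - z)" using ST u zT by (intro LA) auto
        also have "\<dots> \<le> LA * e" using Sz[OF u] nonneg by (intro mult_left_mono)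
        finally show "spectral_norm (tjac A u - tjac A z) \<le> LA * e" .
      qed (use yT zT e nonneg in \<open>simp_all add: MA Mc spectral_norm_nonneg\<close>)
      finally have sn: "spectral_norm (tjac A u ** tjac c y) \<le> MA * Lc * e + LA * e * Mc" by simp
      show "onorm (\<lambda>h. h v* tjac A u v* tjac c y) \<le> MA * Lc * e + LA * e * Mc"
        unfolding vector_matrix_mul_assoc
        by (rule onorm_le, rule order_trans[OF norm_vector_matrix_le]) (intro mult_right_mono sn norm_ge_zero)
    qed auto
    then show ?thesis by (simp add: e_def A_fix[OF z(1)] vector_matrix_mult_diff_distrib)
  qed
  define B where "B = Lc * (MA + 1) + LA * Mc"
  have "(y - A y) \<bullet> (tjac c y *v c y) = ((y - A y) v* tjac c y) \<bullet> c y" by (simp add: dot_lmul_matrix)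
  also have "(y - A y) v* tjac c y = c y - (c y - c z - (y - z) v* tjac c y) - (A y - z) v* tjac c y"
    by (simp add: z vector_matrix_mult_diff_distrib)
  also have "\<dots> \<bullet> c y = (norm (c y))\<^sup>2 - (c y - c z - (y - z) v* tjac c y) \<bullet> c y - ((A y - z) v* tjac c y) \<bullet> c y"
    by (simp add: inner_diff_left inner_add_left power2_norm_eq_inner)
  also have "\<dots> \<ge> (norm (c y))\<^sup>2 - Lc * e * e * norm (c y) - (MA * Lc * e + LA * e * Mc) * e * norm (c y)"
    by (intro diff_mono order_refl order_trans[OF norm_cauchy_schwarz]
        mult_right_mono[OF v1] mult_right_mono[OF v2] norm_ge_zero)
  finally have "norm (c y) * (norm (c y) - e * (e * B)) \<le> (y - A y) \<bullet> (tjac c y *v c y)"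
    by (simp add: B_def algebra_simps power2_eq_square)
  moreover have "e * (e * B) < norm (c y)"
  proof -
    have B0: "0 \<le> B" using nonneg by (simp add: B_def)
    have "\<eta> * (Lb + LA * Mc) \<le> \<sigma> / 5" using h3 by (simp add: algebra_simps)
    moreover have "\<eta> * (LA * Mc) \<le> \<eta> * (Lb + LA * Mc)" using e0 nonneg by (intro mult_left_mono) auto
    moreover have "\<eta> * (Lc * (MA + 1)) \<le> \<sigma> / 32" using h2 by (simp add: algebra_simps)
    ultimately have "\<eta> * B \<le> 37/160 * \<sigma>" by (simp add: B_def distrib_left)
    have "e * B \<le> (31/15 * \<eta>) * B" using e B0 by (intro mult_right_mono)
    also have "\<dots> \<le> 31/15 * (37/160 * \<sigma>)" using \<open>\<eta> * B \<le> 37/160 * \<sigma>\<close> by (simp add: mult_ac)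
    finally have "e * (e * B) \<le> e * (31/15 * (37/160 * \<sigma>))" using e by (intro mult_left_mono)
    \<comment> \<open>The error bound absorbs the factor \<open>\<sigma> e\<close>; the constant in front of \<open>norm (c y)\<close> is about 0.51.\<close>
    also have "\<dots> = (31/15 * 37/160 * 16/15) * (\<sigma> * (15/16) * e)" by simp
    also have "\<dots> \<le> (31/15 * 37/160 * 16/15) * norm (c y)" using ze by (intro mult_left_mono) (simp_all add: e_def)
    also have "\<dots> < norm (c y)" using cy by simp
    finally show ?thesis .
  qed
  ultimately show ?thesis using cy by (smt (verit) mult_pos_pos zero_less_norm_iff)
qed

end

end

section \<open>Gradients, Hessians and second-order limits\<close>

lemma grad_eqI:
  fixes f :: "real^'n \<Rightarrow> real"
  assumes "(f has_derivative (\<lambda>h. g \<bullet> h)) (at x)"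
  shows "grad f x = g"
proof -
  have "frechet_derivative f (at x) = (\<lambda>h. g \<bullet> h)" using frechet_derivative_at[OF assms] by simp
  then show ?thesis by (simp add: grad_def vec_eq_iff inner_axis)
qed

lemma has_derivative_grad:
  fixes f :: "real^'n \<Rightarrow> real"
  assumes "f differentiable (at x)"
  shows "(f has_derivative (\<lambda>h. grad f x \<bullet> h)) (at x)"
proof -
  let ?F = "frechet_derivative f (at x)"
  have F: "(f has_derivative ?F) (at x)" using assms by (simp add: frechet_derivative_works)
  have lin: "linear ?F" using F by (rule has_derivative_linear)
  have "?F = (\<lambda>h. grad f x \<bullet> h)"
  proof
    fix h
    have "?F h = ?F (\<Sum>i\<in>UNIV. h $ i *\<^sub>R axis i 1)" by (simp add: basis_expansion flip: scalar_mult_eq_scaleR)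
    also have "\<dots> = (\<Sum>i\<in>UNIV. h $ i * ?F (axis i 1))"
      by (simp add: linear_sum[OF lin] linear_cmul[OF lin])
    also have "\<dots> = grad f x \<bullet> h" by (simp add: grad_def inner_vec_def mult.commute)
    finally show "?F h = grad f x \<bullet> h" .
  qed
  with F show ?thesis by simp
qed

lemma hess_apply:
  assumes "(grad f has_derivative D) (at x)"
  shows "hess f x *v d = D d"
  unfolding hess_def jacobian_def frechet_derivative_at[OF assms, symmetric]
  using has_derivative_linear[OF assms] by (simp add: matrix_works)

lemma partials_differentiable:
  fixes g :: "real^'n \<Rightarrow> 'b::euclidean_space"
  assumes "twice_differentiable g"
  shows "(\<lambda>z. \<chi> i. frechet_derivative g (at z) (axis i 1)) differentiable (at y)"
proof -
  obtain D where D: "\<And>z. (g has_derivative blinfun_apply (D z)) (at z)" "D differentiable (at y)"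
    using assms unfolding twice_differentiable_def by blast
  define \<psi> :: "((real^'n) \<Rightarrow>\<^sub>L 'b) \<Rightarrow> 'b^'n" where "\<psi> B = (\<chi> i. blinfun_apply B (axis i 1))" for B
  have "bounded_linear \<psi>"
  proof (rule bounded_linear_intro[where K = "real CARD('n)"])
    fix B
    have "norm (\<psi> B) \<le> (\<Sum>i\<in>UNIV. norm (\<psi> B $ i))"
      unfolding norm_vec_def[of "\<psi> B"] by (rule L2_set_le_sum) simp
    also have "\<dots> \<le> (\<Sum>i\<in>(UNIV::'n set). norm B)"
      unfolding \<psi>_def using norm_blinfun[of B "axis _ 1"] by (intro sum_mono) simp
    finally show "norm (\<psi> B) \<le> norm B * real CARD('n)" by (simp add: mult.commute)
  qed (simp_all add: \<psi>_def vec_eq_iff blinfun.add_left blinfun.scaleR_left)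
  then have "(\<lambda>z. \<psi> (D z)) differentiable (at y)"
    using D(2) unfolding differentiable_def by (blast intro: bounded_linear.has_derivative)
  moreover have "frechet_derivative g (at z) = blinfun_apply (D z)" for z
    using frechet_derivative_at[OF D(1)] by simp
  ultimately show ?thesis by (simp add: \<psi>_def)
qed

lemma grad_differentiable: "twice_differentiable f \<Longrightarrow> grad f differentiable (at y)"
  for f :: "real^'n \<Rightarrow> real"
  using partials_differentiable[of f y] by (simp add: grad_def[abs_def])

lemma tjac_differentiable: "twice_differentiable c \<Longrightarrow> tjac c differentiable (at y)"
  for c :: "real^'n \<Rightarrow> real^'p"
proof -
  have "tjac c = (\<lambda>z. \<chi> i. frechet_derivative c (at z) (axis i 1))"
    by (simp add: fun_eq_iff vec_eq_iff tjac_def jacobian_def matrix_def transpose_def)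
  then show "twice_differentiable c \<Longrightarrow> tjac c differentiable (at y)"
    using partials_differentiable[of c y] by simp
qed

lemma bounded_bilinear_matrix_vector_mult:
  "bounded_bilinear (\<lambda>(M :: real^'m^'n) v. M *v v)"
  unfolding bilinear_conv_bounded_bilinear[symmetric] bilinear_def
  by (auto intro!: linearI simp: matrix_vector_mult_add_rdistrib matrix_vector_right_distrib
      matrix_vector_mult_scaleR scaleR_matrix_vector_assoc[symmetric])

lemmas has_derivative_matrix_vector_mult =
  bounded_bilinear.FDERIV[OF bounded_bilinear_matrix_vector_mult]

text \<open>The mean value theorem in the direction \<open>w\<close> turns the second difference of \<open>\<phi>\<close> into a difference of
gradients, which the derivative of \<open>g\<close> at the single point \<open>y\<close> approximates up to \<open>o(t)\<close>. The
second difference is symmetric in \<open>u\<close> and \<open>w\<close>, so its limit \<open>w \<bullet> B u\<close> is as well.\<close>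

lemma gradient_derivative_second_difference:
  fixes \<phi> :: "'a::real_inner \<Rightarrow> real" and g :: "'a \<Rightarrow> 'a"
  assumes phi: "\<And>z. (\<phi> has_derivative (\<lambda>h. g z \<bullet> h)) (at z)"
    and g: "(g has_derivative B) (at y)" and e: "0 < e"
  shows "\<exists>d>0. \<forall>t. 0 < t \<longrightarrow> t < d \<longrightarrow>
    \<bar>\<phi> (y + t *\<^sub>R u + t *\<^sub>R w) - \<phi> (y + t *\<^sub>R w) - \<phi> (y + t *\<^sub>R u) + \<phi> y - t\<^sup>2 * (w \<bullet> B u)\<bar> \<le> e * t\<^sup>2"
proof -
  define N where "N = norm u + norm w + 1"
  have N: "0 < N" by (simp add: N_def add_nonneg_pos)
  define e' where "e' = e / (2 * N\<^sup>2)"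
  have e': "0 < e'" using e N by (simp add: e'_def)
  interpret B: bounded_linear B by (rule has_derivative_bounded_linear[OF g])
  obtain \<delta> where \<delta>: "0 < \<delta>" and rem: "\<And>z. norm (z - y) < \<delta> \<Longrightarrow> norm (g z - g y - B (z - y)) \<le> e' * norm (z - y)"
    using g e' unfolding has_derivative_at_alt by blast
  show ?thesis
  proof (intro exI[of _ "\<delta> / N"] conjI allI impI)
    show "0 < \<delta> / N" using \<delta> N by simp
    fix t :: real assume t: "0 < t" "t < \<delta> / N"
    define q where "q s = \<phi> (y + t *\<^sub>R u + (s * t) *\<^sub>R w) - \<phi> (y + (s * t) *\<^sub>R w)" for s
    define q' where "q' s h = g (y + t *\<^sub>R u + (s * t) *\<^sub>R w) \<bullet> ((h * t) *\<^sub>R w) - g (y + (s * t) *\<^sub>R w) \<bullet> ((h * t) *\<^sub>R w)" for s h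
    have "(q has_derivative q' s) (at s within {0..1})" for s
      unfolding q_def q'_def
      by (intro has_derivative_diff has_derivative_compose[OF _ phi]) (auto intro!: derivative_eq_intros)
    then obtain \<theta> where th: "\<theta> \<in> {0<..<1}" "q 1 - q 0 = q' \<theta> (1 - 0)"
      using mvt_simple[of 0 1 q q'] by auto
    define a where "a = t *\<^sub>R u + (\<theta> * t) *\<^sub>R w"
    define b where "b = (\<theta> * t) *\<^sub>R w"
    have tw: "norm ((\<theta> * t) *\<^sub>R w) \<le> t * norm w"
      using th t by (simp add: abs_mult mult_right_mono mult_le_cancel_right1)
    have tN_eq: "t * N = t * norm u + t * norm w + t" by (simp add: N_def algebra_simps)
    have tu: "0 \<le> t * norm u" using t by simp
    have na: "norm a \<le> t * N"
      using norm_triangle_ineq[of "t *\<^sub>R u" "(\<theta> * t) *\<^sub>R w"] tw t(1) unfolding a_def tN_eq by simp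
    have nb: "norm b \<le> t * N"
      using tw t(1) tu unfolding b_def tN_eq by linarith
    have tN: "t * N < \<delta>" using t N by (simp add: field_simps)
    have ra: "norm (g (y + a) - g y - B a) \<le> e' * (t * N)"
      using rem[of "y + a"] na tN
      by (intro order_trans[OF _ mult_left_mono[OF na less_imp_le[OF e']]]) simp
    have rb: "norm (g (y + b) - g y - B b) \<le> e' * (t * N)"
      using rem[of "y + b"] nb tN
      by (intro order_trans[OF _ mult_left_mono[OF nb less_imp_le[OF e']]]) simp
    have Bab: "B a - B b = t *\<^sub>R B u" unfolding a_def b_def by (simp add: B.add B.scaleR)
    have "q 1 - q 0 = t * (w \<bullet> (g (y + a) - g (y + b)))"
      using th(2) unfolding q'_def a_def b_def by (simp add: algebra_simps inner_diff_right inner_commute)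
    also have "g (y + a) - g (y + b) = t *\<^sub>R B u + ((g (y + a) - g y - B a) - (g (y + b) - g y - B b))"
      by (simp add: Bab[symmetric])
    finally have "q 1 - q 0 - t\<^sup>2 * (w \<bullet> B u) = t * (w \<bullet> ((g (y + a) - g y - B a) - (g (y + b) - g y - B b)))"
      by (simp add: inner_add_right power2_eq_square algebra_simps)
    also have "\<bar>\<dots>\<bar> \<le> t * (norm w * (2 * (e' * (t * N))))"
    proof -
      have "norm ((g (y + a) - g y - B a) - (g (y + b) - g y - B b)) \<le> 2 * (e' * (t * N))"
        using norm_triangle_ineq4[of "g (y + a) - g y - B a" "g (y + b) - g y - B b"] ra rb by simp
      then have "\<bar>w \<bullet> ((g (y + a) - g y - B a) - (g (y + b) - g y - B b))\<bar> \<le> norm w * (2 * (e' * (t * N)))"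
        by (intro order_trans[OF Cauchy_Schwarz_ineq2] mult_left_mono) auto
      then show ?thesis using t by (simp add: abs_mult)
    qed
    also have "\<dots> \<le> t * (N * (2 * (e' * (t * N))))"
      using t e' N by (intro mult_left_mono mult_right_mono) (auto simp: N_def)
    also have "\<dots> = e * t\<^sup>2" using N by (simp add: e'_def power2_eq_square field_simps)
    finally show "\<bar>\<phi> (y + t *\<^sub>R u + t *\<^sub>R w) - \<phi> (y + t *\<^sub>R w) - \<phi> (y + t *\<^sub>R u) + \<phi> y - t\<^sup>2 * (w \<bullet> B u)\<bar> \<le> e * t\<^sup>2"
      by (simp add: q_def)
  qed
qed

lemma gradient_derivative_symmetric:
  fixes \<phi> :: "'a::real_inner \<Rightarrow> real" and g :: "'a \<Rightarrow> 'a"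
  assumes phi: "\<And>z. (\<phi> has_derivative (\<lambda>h. g z \<bullet> h)) (at z)"
    and g: "(g has_derivative B) (at y)"
  shows "u \<bullet> B w = w \<bullet> B u"
proof -
  have "\<bar>w \<bullet> B u - u \<bullet> B w\<bar> \<le> 0 + 2 * e" if e: "0 < e" for e
  proof -
    obtain d1 where d1: "d1 > 0" "\<And>t. 0 < t \<Longrightarrow> t < d1 \<Longrightarrow>
      \<bar>\<phi> (y + t *\<^sub>R u + t *\<^sub>R w) - \<phi> (y + t *\<^sub>R w) - \<phi> (y + t *\<^sub>R u) + \<phi> y - t\<^sup>2 * (w \<bullet> B u)\<bar> \<le> e * t\<^sup>2"
      using gradient_derivative_second_difference[OF phi g e] by blast
    obtain d2 where d2: "d2 > 0" "\<And>t. 0 < t \<Longrightarrow> t < d2 \<Longrightarrow>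
      \<bar>\<phi> (y + t *\<^sub>R w + t *\<^sub>R u) - \<phi> (y + t *\<^sub>R u) - \<phi> (y + t *\<^sub>R w) + \<phi> y - t\<^sup>2 * (u \<bullet> B w)\<bar> \<le> e * t\<^sup>2"
      using gradient_derivative_second_difference[OF phi g e] by blast
    define t where "t = min d1 d2 / 2"
    have t: "0 < t" "t < d1" "t < d2" using d1(1) d2(1) by (auto simp: t_def)
    have eq: "y + t *\<^sub>R w + t *\<^sub>R u = y + t *\<^sub>R u + t *\<^sub>R w" by simp
    have "\<bar>t\<^sup>2 * (w \<bullet> B u) - t\<^sup>2 * (u \<bullet> B w)\<bar> \<le> 2 * (e * t\<^sup>2)"
      using d1(2)[OF t(1,2)] d2(2)[OF t(1,3)] unfolding eq by linarith
    also have "t\<^sup>2 * (w \<bullet> B u) - t\<^sup>2 * (u \<bullet> B w) = t\<^sup>2 * (w \<bullet> B u - u \<bullet> B w)" by (simp add: algebra_simps)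
    also have "\<bar>\<dots>\<bar> = t\<^sup>2 * \<bar>w \<bullet> B u - u \<bullet> B w\<bar>" by (simp add: abs_mult)
    finally have "t\<^sup>2 * \<bar>w \<bullet> B u - u \<bullet> B w\<bar> \<le> t\<^sup>2 * (2 * e)" by (simp add: mult_ac)
    then show ?thesis using t(1) by simp
  qed
  then have "\<bar>w \<bullet> B u - u \<bullet> B w\<bar> \<le> 0 + e" if "0 < e" for e
    using that[THEN half_gt_zero] by fastforce
  then have "\<bar>w \<bullet> B u - u \<bullet> B w\<bar> \<le> 0" by (rule field_le_epsilon)
  then show ?thesis by simp
qed

lemma has_derivative_imp_quotient_tendsto:
  fixes p :: "real \<Rightarrow> 'b::real_normed_vector"
  assumes "(p has_derivative (\<lambda>t. t *\<^sub>R v)) (at 0)" and "p 0 = 0"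
  shows "((\<lambda>t. p t /\<^sub>R t) \<longlongrightarrow> v) (at_right 0)"
proof -
  have "((\<lambda>t. (p t - p 0 - (t - 0) *\<^sub>R v) /\<^sub>R norm (t - 0)) \<longlongrightarrow> 0) (at 0)"
    using assms(1) unfolding has_derivative_at_within by simp
  then have "((\<lambda>t. (p t - t *\<^sub>R v) /\<^sub>R norm t) \<longlongrightarrow> 0) (at_right 0)"
    using assms(2) by (auto intro: tendsto_within_subset)
  then have "((\<lambda>t. p t /\<^sub>R t - v) \<longlongrightarrow> 0) (at_right 0)"
  proof (rule Lim_transform_eventually)
    show "\<forall>\<^sub>F t in at_right 0. (p t - t *\<^sub>R v) /\<^sub>R norm t = p t /\<^sub>R t - v"
      using eventually_at_right_less[of "0::real"] by eventually_elim (simp add: scaleR_diff_right)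
  qed
  then show ?thesis by (simp add: LIM_zero_iff)
qed

section \<open>Second-order stationary points\<close>

lemma grad_component:
  fixes c :: "real^'n \<Rightarrow> real^'p"
  assumes "c differentiable (at y)"
  shows "grad (\<lambda>z. c z $ i) y = column i (tjac c y)"
proof (rule grad_eqI)
  have "((\<lambda>z. c z $ i) has_derivative (\<lambda>h. (h v* tjac c y) $ i)) (at y)"
    by (rule bounded_linear.has_derivative[OF bounded_linear_vec_nth tjac_has_derivative[OF assms]])
  also have "(\<lambda>h. (h v* tjac c y) $ i) = (\<lambda>h. column i (tjac c y) \<bullet> h)"
    by (simp add: fun_eq_iff vector_matrix_mult_def column_def inner_vec_def mult.commute)
  finally show "((\<lambda>z. c z $ i) has_derivative (\<lambda>h. column i (tjac c y) \<bullet> h)) (at y)" .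
qed

lemma sum_grad_components:
  fixes c :: "real^'n \<Rightarrow> real^'p"
  assumes "c differentiable (at y)"
  shows "(\<Sum>i\<in>UNIV. l $ i *\<^sub>R grad (\<lambda>z. c z $ i) y) = tjac c y *v l"
  by (simp add: grad_component[OF assms] matrix_mult_sum scalar_mult_eq_scaleR)

lemma sum_hess_components:
  fixes c :: "real^'n \<Rightarrow> real^'p"
  assumes c: "\<And>z. c differentiable (at z)" and DC: "(tjac c has_derivative DC) (at y)"
  shows "(\<Sum>i\<in>UNIV. l $ i *\<^sub>R hess (\<lambda>z. c z $ i) y) *v d = DC d *v l"
proof -
  have hess: "hess (\<lambda>z. c z $ i) y *v d = column i (DC d)" for i
  proof (rule hess_apply)
    have "bounded_linear (\<lambda>M :: real^'p^'n. column i M)"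
      unfolding linear_conv_bounded_linear[symmetric]
      by (rule linearI) (simp_all add: column_def vec_eq_iff)
    moreover have "grad (\<lambda>z. c z $ i) = (\<lambda>z. column i (tjac c z))"
      by (rule ext) (rule grad_component[OF c])
    ultimately show "(grad (\<lambda>z. c z $ i) has_derivative (\<lambda>d. column i (DC d))) (at y)"
      using bounded_linear.has_derivative[OF _ DC] by simp
  qed
  have "(\<Sum>i\<in>S. l $ i *\<^sub>R hess (\<lambda>z. c z $ i) y) *v d = (\<Sum>i\<in>S. l $ i *\<^sub>R column i (DC d))"
    if "finite S" for S
    using that
    by induction (simp_all add: matrix_vector_mult_add_rdistrib hess flip: scaleR_matrix_vector_assoc)
  then show ?thesis by (simp add: matrix_mult_sum scalar_mult_eq_scaleR)
qed

locale dissolved_problem = constraint_dissolving c X p' A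
  for c :: "real^'n \<Rightarrow> real^'p" and X p' and A +
  fixes f :: "real^'n \<Rightarrow> real"
  assumes f_diff: "f differentiable (at y)"
    and f_twice: "twice_differentiable f"
    and c_twice: "twice_differentiable c"
    and A_twice: "twice_differentiable A"
begin

text \<open>The gradient of \<open>f \<circ> A\<close>, by the chain rule.\<close>

definition pullback_grad :: "real^'n \<Rightarrow> real^'n" where
  "pullback_grad z = tjac A z *v grad f (A z)"

lemma pullback_has_derivative: "((\<lambda>z. f (A z)) has_derivative (\<lambda>h. pullback_grad z \<bullet> h)) (at z)"
proof -
  have "((\<lambda>z. f (A z)) has_derivative (\<lambda>h. grad f (A z) \<bullet> (h v* tjac A z))) (at z)"
    by (rule has_derivative_compose[OF A_has_derivative has_derivative_grad[OF f_diff]])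
  then show ?thesis
    by (simp add: pullback_grad_def inner_matrix_vector_adjoint)
qed

lemma penalty_has_derivative:
  "((\<lambda>z. f (A z) + \<beta> / 2 * (norm (c z))\<^sup>2) has_derivative
    (\<lambda>h. (pullback_grad z + \<beta> *\<^sub>R (tjac c z *v c z)) \<bullet> h)) (at z)"
  unfolding power2_norm_eq_inner
  by (rule has_derivative_eq_rhs, (rule derivative_intros pullback_has_derivative c_has_derivative)+)
     (simp add: fun_eq_iff inner_add_left inner_matrix_vector_adjoint inner_commute[of "_ v* _"])

lemma grad_penalty:
  "grad (\<lambda>z. f (A z) + \<beta> / 2 * (norm (c z))\<^sup>2) = (\<lambda>z. pullback_grad z + \<beta> *\<^sub>R (tjac c z *v c z))"
  by (rule ext) (rule grad_eqI[OF penalty_has_derivative])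

context
  fixes x :: "real^'n" and \<beta> :: real
  assumes cx: "c x = 0" and beta: "beta_tilde p' X f c A x < ereal \<beta>"
begin

lemma threshold_strict:
  assumes z: "z \<in> Omega p' X c A x" and cz: "c z \<noteq> 0"
  shows "(A z - z) \<bullet> pullback_grad z < \<beta> * ((z - A z) \<bullet> (tjac c z *v c z))"
proof -
  let ?N = "(A z - z) \<bullet> pullback_grad z" and ?D = "(z - A z) \<bullet> (tjac c z *v c z)"
  have D: "0 < ?D" by (rule inner_dissolving_direction_pos[OF cx z cz])
  have "ereal (?N / ?D) = quot_zero ?N ?D" using D by (simp add: quot_zero_def)
  also have "\<dots> \<le> beta_tilde p' X f c A x"
    unfolding beta_tilde_def by (rule SUP_upper2[OF z], rule Max_ge) (simp_all add: pullback_grad_def)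
  also have "\<dots> < ereal \<beta>" by (rule beta)
  finally show ?thesis using D by (simp add: field_simps)
qed

lemma threshold:
  assumes z: "z \<in> Omega p' X c A x"
  shows "(A z - z) \<bullet> pullback_grad z \<le> \<beta> * ((z - A z) \<bullet> (tjac c z *v c z))"
  using threshold_strict[OF z] A_fix[of z] by (cases "c z = 0") auto

lemma stationary_imp_feasible:
  assumes z: "z \<in> Omega p' X c A x" and "pullback_grad z + \<beta> *\<^sub>R (tjac c z *v c z) = 0"
  shows "c z = 0"
proof (rule ccontr)
  assume cz: "c z \<noteq> 0"
  have "pullback_grad z = - (\<beta> *\<^sub>R (tjac c z *v c z))" using assms(2) by (simp add: eq_neg_iff_add_eq_0)
  then have "(A z - z) \<bullet> pullback_grad z = \<beta> * ((z - A z) \<bullet> (tjac c z *v c z))"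
    by (simp add: inner_diff_left algebra_simps)
  with threshold_strict[OF z cz] show False by simp
qed

text \<open>A line leaving a boundary point of the ball tangentially leaves the ball. The correction by
\<open>t\<^sup>2 q\<close> towards the center, with \<open>q = K (x - y)\<close> and \<open>K \<parallel>x - y\<parallel>\<^sup>2 = \<parallel>w\<parallel>\<^sup>2\<close>, keeps
the curve inside without changing its velocity.\<close>

lemma curve_in_Omega:
  assumes y: "y \<in> Omega p' X c A x" and w: "w \<bullet> (y - x) \<le> 0"
  obtains q where "\<forall>\<^sub>F t in at_right 0. y + t *\<^sub>R w + t\<^sup>2 *\<^sub>R q \<in> Omega p' X c A x"
proof -
  obtain \<epsilon> where e: "0 < \<epsilon>" "Omega p' X c A x = cball x \<epsilon>" by (rule Omega_cball[OF cx])
  show thesis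
  proof (cases "y = x")
    case True
    have "\<forall>\<^sub>F t in at_right 0. dist (y + t *\<^sub>R w + t\<^sup>2 *\<^sub>R 0) y < \<epsilon>"
    proof -
      have "((\<lambda>t. y + t *\<^sub>R w + t\<^sup>2 *\<^sub>R 0) \<longlongrightarrow> y) (at_right 0)" by (auto intro!: tendsto_eq_intros)
      then show ?thesis using e(1) by (rule tendstoD)
    qed
    then show thesis
      by (intro that[of 0]) (auto elim!: eventually_mono simp: e(2) True dist_commute)
  next
    case False
    define r where "r = norm (y - x)"
    have r: "0 < r" "r \<le> \<epsilon>" using False y by (auto simp: r_def e(2) dist_norm norm_minus_commute)
    define K where "K = (norm w)\<^sup>2 / r\<^sup>2"
    have K: "0 \<le> K" "K * r\<^sup>2 = (norm w)\<^sup>2" using r by (simp_all add: K_def)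
    have "\<forall>\<^sub>F t in at_right 0. K * t\<^sup>2 < 1"
    proof -
      have "((\<lambda>t. K * t\<^sup>2) \<longlongrightarrow> 0) (at_right 0)" by (auto intro!: tendsto_eq_intros)
      then show ?thesis by (rule order_tendstoD) simp
    qed
    then have "\<forall>\<^sub>F t in at_right 0. y + t *\<^sub>R w + t\<^sup>2 *\<^sub>R (K *\<^sub>R (x - y)) \<in> Omega p' X c A x"
      using eventually_at_right_less[of "0::real"]
    proof eventually_elim
      case (elim t)
      define s where "s = K * t\<^sup>2"
      have s: "0 \<le> s" "s < 1" using elim K by (simp_all add: s_def)
      have "y + t *\<^sub>R w + t\<^sup>2 *\<^sub>R (K *\<^sub>R (x - y)) - x = (1 - s) *\<^sub>R (y - x) + t *\<^sub>R w"
        by (simp add: s_def algebra_simps)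
      then have "(norm (y + t *\<^sub>R w + t\<^sup>2 *\<^sub>R (K *\<^sub>R (x - y)) - x))\<^sup>2
          = ((1 - s) *\<^sub>R (y - x) + t *\<^sub>R w) \<bullet> ((1 - s) *\<^sub>R (y - x) + t *\<^sub>R w)"
        by (simp only: power2_norm_eq_inner)
      also have "\<dots> = (1 - s)\<^sup>2 * r\<^sup>2 + 2 * ((1 - s) * t) * (w \<bullet> (y - x)) + t\<^sup>2 * (norm w)\<^sup>2"
        unfolding r_def power2_norm_eq_inner
        by (simp only: inner_add_left inner_add_right inner_scaleR_left inner_scaleR_right
            inner_commute[of "y - x" w] power2_eq_square) (simp add: algebra_simps)
      also have "\<dots> \<le> (1 - s)\<^sup>2 * r\<^sup>2 + 0 + s * r\<^sup>2"
      proof (intro add_mono order_refl)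
        show "2 * ((1 - s) * t) * (w \<bullet> (y - x)) \<le> 0" using w s elim by (intro mult_nonneg_nonpos) auto
        show "t\<^sup>2 * (norm w)\<^sup>2 \<le> s * r\<^sup>2" unfolding K(2)[symmetric] s_def by (simp add: mult_ac)
      qed
      also have "\<dots> = (1 - s * (1 - s)) * r\<^sup>2" by (simp add: algebra_simps power2_eq_square)
      also have "\<dots> \<le> 1 * r\<^sup>2" using s by (intro mult_right_mono) auto
      finally have "(norm (y + t *\<^sub>R w + t\<^sup>2 *\<^sub>R (K *\<^sub>R (x - y)) - x))\<^sup>2 \<le> r\<^sup>2"
        by simp
      then have "norm (y + t *\<^sub>R w + t\<^sup>2 *\<^sub>R (K *\<^sub>R (x - y)) - x) \<le> r"
        by (rule power2_le_imp_le) (simp add: r_def)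
      then show ?case using r by (simp add: e(2) dist_norm norm_minus_commute)
    qed
    then show thesis by (rule that)
  qed
qed

text \<open>Along a curve \<open>\<gamma>\<close> in \<open>Omega\<close> with velocity \<open>w\<close>, both sides of the inequality \<open>threshold\<close>
vanish to second order at \<open>y\<close>, because \<open>\<gamma> - A \<circ> \<gamma>\<close>, the gradient of \<open>f \<circ> A\<close> and
\<open>tjac c *v c\<close> are all zero there. Dividing by \<open>t\<^sup>2\<close> and passing to the limit gives the claim,
where \<open>w - D A y w = w\<close>.\<close>

lemma normal_curvature_inward:
  assumes y: "y \<in> Omega p' X c A x" and cy: "c y = 0" and w: "w v* tjac A y = 0"
    and k0: "pullback_grad y = 0" and B: "(pullback_grad has_derivative B) (at y)"
    and inward: "w \<bullet> (y - x) \<le> 0"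
  shows "0 \<le> w \<bullet> B w + \<beta> * (w \<bullet> (tjac c y *v (w v* tjac c y)))"
proof -
  obtain q where q: "\<forall>\<^sub>F t in at_right 0. y + t *\<^sub>R w + t\<^sup>2 *\<^sub>R q \<in> Omega p' X c A x"
    by (rule curve_in_Omega[OF y inward])
  define \<gamma> where "\<gamma> t = y + t *\<^sub>R w + t\<^sup>2 *\<^sub>R q" for t :: real
  have \<gamma>0: "\<gamma> 0 = y" by (simp add: \<gamma>_def)
  have \<gamma>: "(\<gamma> has_derivative (\<lambda>t. t *\<^sub>R w)) (at 0)"
    unfolding \<gamma>_def by (auto intro!: derivative_eq_intros)
  have chain: "((\<lambda>t. \<phi> (\<gamma> t) /\<^sub>R t) \<longlongrightarrow> D w) (at_right 0)"
    if \<phi>: "(\<phi> has_derivative D) (at y)" "\<phi> y = 0" for \<phi> D :: "real^'n \<Rightarrow> real^'n"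
  proof (rule has_derivative_imp_quotient_tendsto)
    interpret D: bounded_linear D by (rule has_derivative_bounded_linear[OF \<phi>(1)])
    have "((\<lambda>t. \<phi> (\<gamma> t)) has_derivative (\<lambda>t. D (t *\<^sub>R w))) (at 0)"
      by (rule has_derivative_compose[OF \<gamma>]) (simp add: \<gamma>0 \<phi>)
    then show "((\<lambda>t. \<phi> (\<gamma> t)) has_derivative (\<lambda>t. t *\<^sub>R D w)) (at 0)" by (simp add: D.scaleR)
  qed (simp add: \<gamma>0 \<phi>)
  obtain DC where DC: "(tjac c has_derivative DC) (at y)"
    using tjac_differentiable[OF c_twice] unfolding differentiable_def by blast
  have l1: "((\<lambda>t. (\<gamma> t - A (\<gamma> t)) /\<^sub>R t) \<longlongrightarrow> w - w v* tjac A y) (at_right 0)"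
    by (rule chain[where \<phi> = "\<lambda>z. z - A z"])
       (auto intro!: has_derivative_diff has_derivative_ident A_has_derivative simp: A_fix cy)
  have l2: "((\<lambda>t. pullback_grad (\<gamma> t) /\<^sub>R t) \<longlongrightarrow> B w) (at_right 0)"
    by (rule chain[OF B k0])
  have l3: "((\<lambda>t. (tjac c (\<gamma> t) *v c (\<gamma> t)) /\<^sub>R t) \<longlongrightarrow> tjac c y *v (w v* tjac c y) + DC w *v c y) (at_right 0)"
    by (rule chain[OF has_derivative_matrix_vector_mult[OF DC c_has_derivative]]) (simp add: cy)
  have "((\<lambda>t. ((\<gamma> t - A (\<gamma> t)) /\<^sub>R t) \<bullet> (pullback_grad (\<gamma> t) /\<^sub>R t)
      + \<beta> * (((\<gamma> t - A (\<gamma> t)) /\<^sub>R t) \<bullet> ((tjac c (\<gamma> t) *v c (\<gamma> t)) /\<^sub>R t)))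
    \<longlongrightarrow> (w - w v* tjac A y) \<bullet> B w + \<beta> * ((w - w v* tjac A y) \<bullet> (tjac c y *v (w v* tjac c y) + DC w *v c y))) (at_right 0)"
    by (intro tendsto_intros l1 l2 l3)
  moreover have "\<forall>\<^sub>F t in at_right 0. 0 \<le> ((\<gamma> t - A (\<gamma> t)) /\<^sub>R t) \<bullet> (pullback_grad (\<gamma> t) /\<^sub>R t)
      + \<beta> * (((\<gamma> t - A (\<gamma> t)) /\<^sub>R t) \<bullet> ((tjac c (\<gamma> t) *v c (\<gamma> t)) /\<^sub>R t))"
    using q
  proof eventually_elim
    case (elim t)
    have "0 \<le> (\<gamma> t - A (\<gamma> t)) \<bullet> pullback_grad (\<gamma> t) + \<beta> * ((\<gamma> t - A (\<gamma> t)) \<bullet> (tjac c (\<gamma> t) *v c (\<gamma> t)))"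
      using threshold[OF elim, folded \<gamma>_def] by (simp add: inner_diff_left algebra_simps)
    then have "0 \<le> (inverse t)\<^sup>2 * ((\<gamma> t - A (\<gamma> t)) \<bullet> pullback_grad (\<gamma> t) + \<beta> * ((\<gamma> t - A (\<gamma> t)) \<bullet> (tjac c (\<gamma> t) *v c (\<gamma> t))))"
      by simp
    also have "\<dots> = ((\<gamma> t - A (\<gamma> t)) /\<^sub>R t) \<bullet> (pullback_grad (\<gamma> t) /\<^sub>R t)
      + \<beta> * (((\<gamma> t - A (\<gamma> t)) /\<^sub>R t) \<bullet> ((tjac c (\<gamma> t) *v c (\<gamma> t)) /\<^sub>R t))"
      by (simp only: inner_scaleR_left inner_scaleR_right) (simp add: power2_eq_square algebra_simps)
    finally show ?case .
  qed
  ultimately have "0 \<le> (w - w v* tjac A y) \<bullet> B w + \<beta> * ((w - w v* tjac A y) \<bullet> (tjac c y *v (w v* tjac c y) + DC w *v c y))"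
    by (rule tendsto_lowerbound) simp
  then show ?thesis by (simp add: w cy)
qed

text \<open>The quadratic form is even, and one of \<open>w\<close>, \<open>- w\<close> does not point out of the ball.\<close>

lemma normal_curvature:
  assumes y: "y \<in> Omega p' X c A x" and cy: "c y = 0" and w: "w v* tjac A y = 0"
    and k0: "pullback_grad y = 0" and B: "(pullback_grad has_derivative B) (at y)"
  shows "0 \<le> w \<bullet> B w + \<beta> * (w \<bullet> (tjac c y *v (w v* tjac c y)))"
proof (cases "w \<bullet> (y - x) \<le> 0")
  case True
  then show ?thesis by (rule normal_curvature_inward[OF y cy w k0 B])
next
  case False
  have neg: "(- v) v* M = - (v v* M)" for v and M :: "real^'m^'n"
    by (rule linear_neg[OF bounded_linear.linear[OF bounded_linear_vector_matrix_mult]])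
  have "(- w) v* tjac A y = 0" by (simp add: neg w)
  moreover have "(- w) \<bullet> (y - x) \<le> 0" using False by simp
  moreover have "tjac c y *v (- v) = - (tjac c y *v v)" for v
    using linear_neg[OF matrix_vector_mul_linear] by blast
  ultimately show ?thesis using normal_curvature_inward[OF y cy _ k0 B, of "- w"]
    by (simp add: linear_neg[OF has_derivative_linear[OF B]] neg)
qed

end

text \<open>The residual \<open>r\<close> of the least-squares multiplier is tangent, hence fixed by \<open>D A y\<close>; so
\<open>tjac A y *v grad f y = 0\<close> forces it to be orthogonal to the gradient of \<open>f\<close>. Being also
orthogonal to the range of \<open>tjac c y\<close>, it is orthogonal to itself.\<close>

lemma multiplier_exists_iff:
  assumes cy: "c y = 0"
  shows "(\<exists>l. grad f y = tjac c y *v l) \<longleftrightarrow> pullback_grad y = 0"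
    and "pullback_grad y = 0 \<Longrightarrow> tjac c y *v (pinv (tjac c y) *v grad f y) = grad f y"
proof -
  have Ay: "A y = y" by (rule A_fix[OF cy])
  show *: "tjac c y *v (pinv (tjac c y) *v grad f y) = grad f y" if k: "pullback_grad y = 0"
  proof -
    define r where "r = grad f y - tjac c y *v (pinv (tjac c y) *v grad f y)"
    have "(r v* tjac c y) \<bullet> v = 0" for v
      by (simp add: dot_lmul_matrix r_def inner_diff_left pinv_apply)
    then have tan: "r v* tjac c y = 0" by (metis inner_eq_zero_iff)
    have "r \<bullet> grad f y = (r v* tjac A y) \<bullet> grad f y" by (simp add: DA_tangent[OF cy tan])
    also have "\<dots> = 0" using k by (simp add: dot_lmul_matrix pullback_grad_def Ay)
    finally have "r \<bullet> grad f y = 0" .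
    moreover have "r \<bullet> (tjac c y *v v) = 0" for v by (simp add: tan flip: dot_lmul_matrix)
    moreover have "r \<bullet> r = r \<bullet> grad f y - r \<bullet> (tjac c y *v (pinv (tjac c y) *v grad f y))"
      by (subst (2) r_def) (rule inner_diff_right)
    ultimately have "r \<bullet> r = 0" by simp
    then show ?thesis by (simp add: r_def)
  qed
  show "(\<exists>l. grad f y = tjac c y *v l) \<longleftrightarrow> pullback_grad y = 0"
  proof
    assume "\<exists>l. grad f y = tjac c y *v l"
    then obtain l where "grad f y = tjac c y *v l" ..
    then show "pullback_grad y = 0"
      by (simp add: pullback_grad_def Ay matrix_vector_mul_assoc JA_Jc[OF cy])
  next
    assume "pullback_grad y = 0"
    from *[OF this] show "\<exists>l. grad f y = tjac c y *v l" by metis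
  qed
qed

lemma fosp_iff: "fosp_constrained f c y \<longleftrightarrow> c y = 0 \<and> pullback_grad y = 0"
  unfolding fosp_constrained_def sum_grad_components[OF c_diff]
  using multiplier_exists_iff(1)[of y] by auto

text \<open>The second derivative of \<open>A\<close> enters \<open>B u\<close> only through \<open>DA u *v grad f y\<close>. As
\<open>tjac A z *v (tjac c z *v l)\<close> is zero at all feasible \<open>z\<close>, its derivative along the tangent \<open>u\<close>
expresses this term by the second derivatives of \<open>c\<close>.\<close>

lemma tangent_curvature:
  assumes cy: "c y = 0" and lam: "grad f y = tjac c y *v l"
    and DC: "(tjac c has_derivative DC) (at y)"
    and B: "(pullback_grad has_derivative B) (at y)"
    and u: "u v* tjac c y = 0"
  shows "d \<bullet> B u = (d v* tjac A y) \<bullet> ((hess f y - (\<Sum>i\<in>UNIV. l $ i *\<^sub>R hess (\<lambda>z. c z $ i) y)) *v u)"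
proof -
  have Ay: "A y = y" by (rule A_fix[OF cy])
  obtain DA where DA: "(tjac A has_derivative DA) (at y)"
    using tjac_differentiable[OF A_twice] unfolding differentiable_def by blast
  obtain DF where DF: "(grad f has_derivative DF) (at y)"
    using grad_differentiable[OF f_twice] unfolding differentiable_def by blast
  have "(grad f has_derivative DF) (at (A y))" using DF Ay by simp
  from has_derivative_compose[OF A_has_derivative this]
  have gfA: "((\<lambda>z. grad f (A z)) has_derivative (\<lambda>h. DF (h v* tjac A y))) (at y)" .
  have "(pullback_grad has_derivative (\<lambda>h. tjac A y *v DF (h v* tjac A y) + DA h *v grad f (A y))) (at y)"
    unfolding pullback_grad_def[abs_def] by (rule has_derivative_matrix_vector_mult[OF DA gfA])
  then have "B = (\<lambda>h. tjac A y *v DF (h v* tjac A y) + DA h *v grad f (A y))"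
    by (rule has_derivative_unique[OF B])
  then have Bu: "B u = tjac A y *v DF u + DA u *v (tjac c y *v l)"
    by (simp add: Ay lam DA_tangent[OF cy u])
  have "((\<lambda>z. tjac c z *v l) has_derivative (\<lambda>h. DC h *v l)) (at y)"
    using has_derivative_matrix_vector_mult[OF DC has_derivative_const[of l]] by simp
  from has_derivative_matrix_vector_mult[OF DA this]
  have "((\<lambda>z. tjac A z *v (tjac c z *v l)) has_derivative (\<lambda>h. tjac A y *v (DC h *v l) + DA h *v (tjac c y *v l))) (at y)" .
  then have "tjac A y *v (DC u *v l) + DA u *v (tjac c y *v l) = 0"
    by (rule tangent_derivative_zero[OF cy _ _ u]) (simp add: matrix_vector_mul_assoc JA_Jc)
  then have "B u = tjac A y *v (DF u - DC u *v l)"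
    unfolding Bu by (simp add: matrix_vector_mult_diff_distrib algebra_simps eq_neg_iff_add_eq_0)
  moreover have "(hess f y - (\<Sum>i\<in>UNIV. l $ i *\<^sub>R hess (\<lambda>z. c z $ i) y)) *v u = DF u - DC u *v l"
    by (simp add: matrix_vector_mult_diff_rdistrib hess_apply[OF DF] sum_hess_components[OF c_diff DC])
  ultimately show ?thesis by (simp add: dot_lmul_matrix)
qed

text \<open>For \<open>d = u + w\<close> with \<open>u = D A y d\<close>, \<open>tangent_curvature\<close> gives \<open>w \<bullet> B u = 0\<close>, and by symmetry of
second derivatives \<open>u \<bullet> B w = 0\<close>. The form splits into the Lagrangian form at \<open>u\<close> and the
nonnegative form at \<open>w\<close>.\<close>

theorem second_order_equivalence:
  assumes cx: "c x = 0" and beta: "beta_tilde p' X f c A x < ereal \<beta>" and y: "y \<in> Omega p' X c A x"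
  shows "sosp_constrained f c y \<longleftrightarrow> sosp_unconstrained (\<lambda>z. f (A z) + \<beta> / 2 * (norm (c z))\<^sup>2) y"
proof -
  let ?h = "\<lambda>z. f (A z) + \<beta> / 2 * (norm (c z))\<^sup>2"
  have first: "grad ?h y = 0 \<longleftrightarrow> fosp_constrained f c y"
    using stationary_imp_feasible[OF cx beta y] unfolding grad_penalty fosp_iff by auto
  have "(\<forall>d. 0 \<le> d \<bullet> (hess ?h y *v d)) \<longleftrightarrow>
      (\<forall>d. d v* tjac c y = 0 \<longrightarrow>
        0 \<le> d \<bullet> ((hess f y - (\<Sum>i\<in>UNIV. (pinv (tjac c y) *v grad f y) $ i *\<^sub>R hess (\<lambda>z. c z $ i) y)) *v d))"
    if fosp: "fosp_constrained f c y"
  proof -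
    define l where "l = pinv (tjac c y) *v grad f y"
    define L where "L = hess f y - (\<Sum>i\<in>UNIV. l $ i *\<^sub>R hess (\<lambda>z. c z $ i) y)"
    have cy: "c y = 0" and k0: "pullback_grad y = 0" using fosp by (simp_all add: fosp_iff)
    have lam: "grad f y = tjac c y *v l" unfolding l_def using multiplier_exists_iff(2)[OF cy k0] by simp
    obtain DC where DC: "(tjac c has_derivative DC) (at y)"
      using tjac_differentiable[OF c_twice] unfolding differentiable_def by blast
    have "pullback_grad differentiable (at y)"
    proof -
      have "(\<lambda>z. grad f (A z)) differentiable (at y)"
        using differentiable_compose[OF grad_differentiable[OF f_twice] A_diff] .
      then show ?thesis
        using tjac_differentiable[OF A_twice, of y] has_derivative_matrix_vector_mult
        unfolding differentiable_def pullback_grad_def[abs_def] by blast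
    qed
    then obtain B where B: "(pullback_grad has_derivative B) (at y)" unfolding differentiable_def by blast
    interpret B: bounded_linear B by (rule has_derivative_bounded_linear[OF B])
    have hess: "hess ?h y *v d = B d + \<beta> *\<^sub>R (tjac c y *v (d v* tjac c y))" for d
    proof -
      have "(grad ?h has_derivative (\<lambda>d. B d + \<beta> *\<^sub>R (tjac c y *v (d v* tjac c y) + DC d *v c y))) (at y)"
        unfolding grad_penalty
        by (intro has_derivative_add B has_derivative_scaleR_right
            has_derivative_matrix_vector_mult[OF DC c_has_derivative])
      from hess_apply[OF this] show ?thesis by (simp add: cy)
    qed
    have hess_quad: "d \<bullet> (hess ?h y *v d) = d \<bullet> B d + \<beta> * (d \<bullet> (tjac c y *v (d v* tjac c y)))" for d
      by (simp only: hess inner_add_right inner_scaleR_right)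
    have tangent: "d \<bullet> B u = (d v* tjac A y) \<bullet> (L *v u)" if "u v* tjac c y = 0" for d u
      unfolding L_def by (rule tangent_curvature[OF cy lam DC B that])
    have "(\<forall>d. 0 \<le> d \<bullet> (hess ?h y *v d)) \<longleftrightarrow> (\<forall>d. d v* tjac c y = 0 \<longrightarrow> 0 \<le> d \<bullet> (L *v d))"
    proof (intro iffI allI impI)
      fix d assume nonneg: "\<forall>d. 0 \<le> d \<bullet> (hess ?h y *v d)" and d: "d v* tjac c y = 0"
      from nonneg have "0 \<le> d \<bullet> B d + \<beta> * (d \<bullet> (tjac c y *v (d v* tjac c y)))"
        unfolding hess_quad by blast
      then show "0 \<le> d \<bullet> (L *v d)" by (simp add: d tangent DA_tangent[OF cy d])
    next
      fix d assume L: "\<forall>d. d v* tjac c y = 0 \<longrightarrow> 0 \<le> d \<bullet> (L *v d)"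
      define u where "u = d v* tjac A y"
      define w where "w = d - u"
      have u: "u v* tjac c y = 0" unfolding u_def by (rule DA_into_tangent[OF cy])
      have uA: "u v* tjac A y = u" by (rule DA_tangent[OF cy u])
      have wA: "w v* tjac A y = 0" by (simp add: w_def vector_matrix_mult_diff_distrib uA) (simp add: u_def)
      have d: "d = u + w" by (simp add: w_def)
      have wu: "w \<bullet> B u = 0" using tangent[OF u, of w] by (simp add: wA)
      have uw: "u \<bullet> B w = 0"
        using gradient_derivative_symmetric[OF pullback_has_derivative B, of u w] wu by simp
      have uu: "0 \<le> u \<bullet> B u" using tangent[OF u, of u] L u by (simp add: uA)
      have ww: "0 \<le> w \<bullet> B w + \<beta> * (w \<bullet> (tjac c y *v (w v* tjac c y)))"
        by (rule normal_curvature[OF cx beta y cy wA k0 B])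
      have uJ: "u \<bullet> (tjac c y *v v) = 0" for v by (simp add: u flip: dot_lmul_matrix)
      have "d v* tjac c y = w v* tjac c y" by (simp add: d vector_matrix_left_distrib u)
      then have "d \<bullet> B d + \<beta> * (d \<bullet> (tjac c y *v (d v* tjac c y))) = u \<bullet> B u + (w \<bullet> B w + \<beta> * (w \<bullet> (tjac c y *v (w v* tjac c y))))"
        by (simp add: d B.add inner_add_left inner_add_right wu uw uJ)
      then show "0 \<le> d \<bullet> (hess ?h y *v d)" unfolding hess_quad using uu ww by simp
    qed
    then show ?thesis by (simp only: L_def l_def)
  qed
  then show ?thesis
    unfolding sosp_constrained_def sosp_unconstrained_def Let_def first by blast
qed

end

theorem theorem2:
  fixes f :: "real^'n \<Rightarrow> real"
    and c :: "real^'n \<Rightarrow> real^'p"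
    and A :: "real^'n \<Rightarrow> real^'n"
    and X :: "(real^'n) set"
    and p' :: nat
    and x :: "real^'n"
    and \<beta> :: real
  assumes f_lip: "locally_lipschitz norm f"
    and f_diff: "\<forall>y. f differentiable (at y)"
    and c_diff: "\<forall>y. c differentiable (at y)"
    and Jc_lip: "locally_lipschitz spectral_norm (tjac c)"
    and p'_bounds: "1 \<le> p'" "p' \<le> CARD('p)"
    and X_nhd: "{y. c y = 0} \<subseteq> interior X"
    and rank_Jc: "\<forall>y\<in>X. rank (tjac c y) = p'"
    and A_diff: "\<forall>y. A differentiable (at y)"
    and JA_lip: "locally_lipschitz spectral_norm (tjac A)"
    and A_fix: "\<forall>y. c y = 0 \<longrightarrow> A y = y"
    and JA_Jc: "\<forall>y. c y = 0 \<longrightarrow> tjac A y ** tjac c y = 0"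
    and f_twice: "twice_differentiable f"
    and c_twice: "twice_differentiable c"
    and A_twice: "twice_differentiable A"
    and x_feasible: "c x = 0"
    and beta: "beta_tilde p' X f c A x < ereal \<beta>"
  shows "\<forall>y \<in> Omega p' X c A x.
           sosp_constrained f c y \<longleftrightarrow>
           sosp_unconstrained (\<lambda>z. f (A z) + \<beta> / 2 * (norm (c z))\<^sup>2) y"
proof -
  interpret dissolved_problem c X p' A f
    by unfold_locales
       (use f_diff c_diff Jc_lip p'_bounds X_nhd rank_Jc A_diff JA_lip A_fix JA_Jc
          f_twice c_twice A_twice in auto)
  show ?thesis
    using second_order_equivalence[OF x_feasible beta] by blast
qed

end
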